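(* There exists a $BV$-homeomorphism $f\colon[-1,1]^2\to[-1,1]^2$ such that both $f$ and $f^{-1}$ satisfy the Luzin $(N)$-condition, $J_f>0$ a.e., $J_{f^{-1}}>0$ a.e., but neither $f$ nor $f^{-1}$ is Sobolev.
   Context: A $BV$-homeomorphism $f\colon[-1,1]^2\to[-1,1]^2$ is a homeomorphism of $[-1,1]^2$ onto itself whose components are of bounded variation on $(-1,1)^2$, i.e. they are integrable and their distributional partial derivatives are signed Radon measures of finite total variation. A mapping $h$ satisfies the Luzin $(N)$-condition if $|h(E)|=0$ for every set $E$ in its domain with $|E|=0$, where $|\cdot|$ is two-dimensional Lebesgue measure. For a $BV$ mapping $h$, $J_h$ is the pointwise Jacobian determinant, i.e. the determinant of the density of the absolutely continuous part of the measure $Dh$ with respect to Lebesgue measure. A mapping is Sobolev if its distributional gradient is represented by a locally integrable function, i.e. it belongs to $W^{1,1}_{\mathrm{loc}}((-1,1)^2;\mathbb{R}^2)$. *)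

theory Defs
  imports "HOL-Analysis.Analysis"
begin

definition open_square :: "(real^2) set" where
  "open_square = box (vec (-1)) (vec 1)"

definition closed_square :: "(real^2) set" where
  "closed_square = cbox (vec (-1)) (vec 1)"

definition partial_deriv :: "'n \<Rightarrow> (real^'n \<Rightarrow> real) \<Rightarrow> real^'n \<Rightarrow> real" where
  "partial_deriv j \<phi> x = frechet_derivative \<phi> (at x) (axis j 1)"

primrec C_k :: "nat \<Rightarrow> (real^'n \<Rightarrow> real) \<Rightarrow> bool" where
  "C_k 0 \<phi> \<longleftrightarrow> continuous_on UNIV \<phi>"
| "C_k (Suc k) \<phi> \<longleftrightarrow> (\<forall>x. \<phi> differentiable (at x)) \<and> (\<forall>j. C_k k (partial_deriv j \<phi>))"

text \<open>Smooth functions with compact support in \<open>U\<close>, extended by zero to the whole space.\<close>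

definition test_functions :: "(real^'n) set \<Rightarrow> (real^'n \<Rightarrow> real) set" where
  "test_functions U =
     {\<phi>. (\<forall>k. C_k k \<phi>) \<and> (\<exists>K. compact K \<and> K \<subseteq> U \<and> (\<forall>x. x \<notin> K \<longrightarrow> \<phi> x = 0))}"

definition finite_borel_on :: "(real^'n) set \<Rightarrow> (real^'n) measure \<Rightarrow> bool" where
  "finite_borel_on U M \<longleftrightarrow> finite_measure M \<and> sets M = sets (restrict_space borel U)"

text \<open>
  A signed Radon measure of finite total variation on \<open>U\<close> is represented by a pair \<open>P\<close>, \<open>N\<close> of
  finite (positive) Borel measures on \<open>U\<close> and stands for \<open>P - N\<close>; by the Jordan decomposition
  every such signed measure arises this way. The pair is not required to be mutually singular.
\<close>

definition distr_deriv_measure ::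
    "(real^'n) set \<Rightarrow> (real^'n \<Rightarrow> real) \<Rightarrow> 'n \<Rightarrow> (real^'n) measure \<Rightarrow> (real^'n) measure \<Rightarrow> bool" where
  "distr_deriv_measure U u j P N \<longleftrightarrow>
     finite_borel_on U P \<and> finite_borel_on U N \<and>
     (\<forall>\<phi>\<in>test_functions U.
        (LINT x:U|lebesgue. u x * partial_deriv j \<phi> x)
          = - ((LINT x|P. \<phi> x) - (LINT x|N. \<phi> x)))"

definition BV_on :: "(real^'n) set \<Rightarrow> (real^'n \<Rightarrow> real) \<Rightarrow> bool" where
  "BV_on U u \<longleftrightarrow> set_integrable lebesgue U u \<and> (\<forall>j. \<exists>P N. distr_deriv_measure U u j P N)"

definition BV_map :: "(real^'n) set \<Rightarrow> (real^'n \<Rightarrow> real^'m) \<Rightarrow> bool" where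
  "BV_map U h \<longleftrightarrow> (\<forall>i. BV_on U (\<lambda>x. h x $ i))"

definition lebesgue_singular :: "(real^'n) measure \<Rightarrow> bool" where
  "lebesgue_singular M \<longleftrightarrow> (\<exists>Z\<in>null_sets lborel. space M - Z \<in> null_sets M)"

text \<open>
  Lebesgue decomposition: the absolutely continuous part of the signed measure \<open>P - N\<close> on \<open>U\<close> has
  density \<open>a\<close>, and its singular part is \<open>S - T\<close>.
\<close>

definition ac_part_density ::
    "(real^'n) set \<Rightarrow> (real^'n) measure \<Rightarrow> (real^'n) measure \<Rightarrow> (real^'n \<Rightarrow> real) \<Rightarrow> bool" where
  "ac_part_density U P N a \<longleftrightarrow>
     set_integrable lebesgue U a \<and>
     (\<exists>S T. finite_borel_on U S \<and> finite_borel_on U T \<and>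
        lebesgue_singular S \<and> lebesgue_singular T \<and>
        (\<forall>E\<in>sets (restrict_space borel U).
           measure P E - measure N E
             = (LINT x:E|lebesgue. a x) + (measure S E - measure T E)))"

text \<open>Row \<open>i\<close>, column \<open>j\<close> holds the density for the \<open>j\<close>-th partial derivative of component \<open>i\<close>.\<close>

definition is_BV_gradient_density ::
    "(real^'n) set \<Rightarrow> (real^'n \<Rightarrow> real^'m) \<Rightarrow> (real^'n \<Rightarrow> real^'n^'m) \<Rightarrow> bool" where
  "is_BV_gradient_density U h A \<longleftrightarrow>
     (\<forall>i j. \<exists>P N. distr_deriv_measure U (\<lambda>x. h x $ i) j P N \<and>
                  ac_part_density U P N (\<lambda>x. A x $ i $ j))"

text \<open>
  For \<open>U\<close> open and \<open>h\<close> of bounded variation the density exists and is unique up to a Lebesgue null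
  set, so only almost-everywhere properties of the chosen representative are meaningful. If \<open>h\<close> is
  not of bounded variation, the value is unspecified.
\<close>

definition BV_jacobian :: "(real^'n) set \<Rightarrow> (real^'n \<Rightarrow> real^'n) \<Rightarrow> real^'n \<Rightarrow> real" where
  "BV_jacobian U h x = det ((SOME A. is_BV_gradient_density U h A) x)"

definition locally_integrable_on :: "(real^'n) set \<Rightarrow> (real^'n \<Rightarrow> real) \<Rightarrow> bool" where
  "locally_integrable_on U u \<longleftrightarrow> (\<forall>K. compact K \<and> K \<subseteq> U \<longrightarrow> set_integrable lebesgue K u)"

text \<open>Membership in the local Sobolev space of exponent \<open>1\<close> and order \<open>1\<close> on \<open>U\<close>.\<close>

definition sobolev_map :: "(real^'n) set \<Rightarrow> (real^'n \<Rightarrow> real^'m) \<Rightarrow> bool" where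
  "sobolev_map U h \<longleftrightarrow>
     (\<forall>i. locally_integrable_on U (\<lambda>x. h x $ i) \<and>
        (\<forall>j. \<exists>v. locally_integrable_on U v \<and>
           (\<forall>\<phi>\<in>test_functions U.
              (LINT x:U|lebesgue. h x $ i * partial_deriv j \<phi> x)
                = - (LINT x:U|lebesgue. \<phi> x * v x))))"

definition luzin_N :: "(real^'n) set \<Rightarrow> (real^'n \<Rightarrow> real^'n) \<Rightarrow> bool" where
  "luzin_N S h \<longleftrightarrow> (\<forall>E\<subseteq>S. negligible E \<longrightarrow> negligible (h ` E))"

end

theory Submission
  imports Defs
begin

text \<open>
  Let \<open>q\<^sub>n\<close> enumerate the rationals. The pure jump function
  \<open>jump s = -1/2 + (\<Sum>n. (1/2)^(n+1) [q\<^sub>n < s])\<close> is strictly increasing with null range, so its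
  generalised inverse \<open>stair\<close> is continuous and increasing with singular derivative. The
  transformations \<open>y \<mapsto> (y + s) / (1 + s y)\<close> of \<open>[-1, 1]\<close> with parameters \<open>s\<close> and \<open>-s\<close> are
  mutually inverse; hence so are the maps that apply them on each vertical line \<open>{x} \<times> [-1, 1]\<close> with
  \<open>s = stair x\<close> and \<open>s = - stair x\<close>, and the two maps play symmetric roles. Vertically they are
  bi-Lipschitz, so the Luzin condition follows from Fubini's theorem. The gradient is lower
  triangular with diagonal \<open>1\<close>, \<open>\<partial>\<^sub>y > 0\<close>; its remaining entry is the image of a bounded density
  \<open>ds dy\<close> under \<open>(s, y) \<mapsto> (jump s, y)\<close>, a nonzero finite measure carried by a null set. So the
  maps are \<open>BV\<close> with positive Jacobian, but not Sobolev.
\<close>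

section \<open>Bump functions\<close>

text \<open>On the diagonal a singular derivative would be fatal: \<open>x + stair x\<close> sends a
  null set onto a set of positive length. Below the diagonal it does no harm, since a lower
  triangular determinant does not see it and vertical lines are preserved. A plain shear by
  \<open>stair x\<close> would do this but leaves the square; the fibre transformations used here
  fix both ends of each vertical line. As negating the parameter inverts them, every property is
  proved once, for a sign \<open>c\<close> with absolute value 1. The singular function is obtained
  through its inverse \<open>jump\<close> because its derivative is then Lebesgue measure pushed
  forward by \<open>jump\<close>, and integration by parts becomes an exchange of two integrals. The
  remaining obstacle lies in the definitions: \<open>BV_jacobian\<close> picks its density by SOME,
  and failing to be Sobolev excludes every candidate \<open>v\<close>. Both demand that a signed
  measure be determined by its integrals against test functions, which is why explicit smooth bumps
  are constructed.\<close>

definition flat_exp :: "nat \<Rightarrow> real \<Rightarrow> real" where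
  "flat_exp n x = (if x \<le> 0 then 0 else inverse x ^ n * exp (- inverse x))"

lemma flat_exp_tendsto_0: "(flat_exp n \<longlongrightarrow> 0) (at 0)"
proof -
  have "((\<lambda>x. flat_exp n x) \<longlongrightarrow> 0) (at_left 0)"
    by (rule tendsto_eventually) (auto simp: flat_exp_def eventually_at_filter)
  moreover have "((\<lambda>x::real. inverse x ^ n / exp (inverse x)) \<longlongrightarrow> 0) (at_right 0)"
    by (rule filterlim_compose[OF tendsto_power_div_exp_0 filterlim_inverse_at_top_right])
  then have "((\<lambda>x. flat_exp n x) \<longlongrightarrow> 0) (at_right 0)"
    by (rule Lim_transform_eventually)
      (auto simp: flat_exp_def eventually_at_filter exp_minus divide_inverse)
  ultimately show ?thesis
    by (simp add: filterlim_split_at)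
qed

text \<open>Both terms of the product rule only raise the power of \<open>inverse x\<close>, so the
  span of the family is closed under differentiation; the index \<open>n\<close> is carried for this
  purpose. At 0 the difference quotient of \<open>flat_exp n\<close> is
  \<open>flat_exp (n + 1)\<close>, which tends to 0.\<close>

lemma flat_exp_has_derivative:
  "(flat_exp n has_real_derivative flat_exp (n + 2) x - real n * flat_exp (n + 1) x) (at x)"
proof (cases x "0::real" rule: linorder_cases)
  case less
  have "((\<lambda>_. 0) has_real_derivative 0) (at x)" by simp
  then have "(flat_exp n has_real_derivative 0) (at x)"
    by (rule has_field_derivative_transform_within_open[of _ _ _ "{..<0}"])
      (use less in \<open>auto simp: flat_exp_def\<close>)
  then show ?thesis using less by (simp add: flat_exp_def)
next
  case equal
  have "((\<lambda>y. (flat_exp n y - flat_exp n 0) / (y - 0)) \<longlongrightarrow> 0) (at 0)"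
    by (rule Lim_transform_eventually[OF flat_exp_tendsto_0[of "n + 1"]])
      (auto simp: flat_exp_def divide_inverse eventually_at_filter)
  then show ?thesis using equal by (simp add: has_field_derivative_iff flat_exp_def)
next
  case greater
  have "((\<lambda>x. inverse x ^ n * exp (- inverse x)) has_real_derivative
     flat_exp (n + 2) x - real n * flat_exp (n + 1) x) (at x)"
    using greater
    apply (auto intro!: derivative_eq_intros simp: flat_exp_def)
    apply (cases n; simp add: field_simps power2_eq_square)
    done
  then show ?thesis
    by (rule has_field_derivative_transform_within_open[of _ _ _ "{0<..}"])
      (use greater in \<open>auto simp: flat_exp_def\<close>)
qed

lemma flat_exp_nonneg: "0 \<le> flat_exp n x"
  by (simp add: flat_exp_def)

text \<open>Each generator has its partial derivatives in the class again, so all members are smooth;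
  \<open>inverse\<close> is included to form \<open>1 - 1 / (1 + n \<psi>)\<close>, which tends to the indicator of
  \<open>{\<psi> > 0}\<close>.\<close>

inductive bump_algebra :: "(real^'n \<Rightarrow> real) \<Rightarrow> bool" where
  const: "bump_algebra (\<lambda>_. c)"
| flat: "bump_algebra (\<lambda>x. flat_exp n (a * x $ i + b))"
| add: "bump_algebra f \<Longrightarrow> bump_algebra g \<Longrightarrow> bump_algebra (\<lambda>x. f x + g x)"
| mult: "bump_algebra f \<Longrightarrow> bump_algebra g \<Longrightarrow> bump_algebra (\<lambda>x. f x * g x)"
| inverse: "bump_algebra f \<Longrightarrow> (\<And>x. f x \<noteq> 0) \<Longrightarrow> bump_algebra (\<lambda>x. inverse (f x))"

text \<open>Induction over the generators. The full derivative \<open>D\<close> is recorded, not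
  only its partial derivatives, because \<open>C_k\<close> asks for differentiability at every
  order.\<close>

lemma bump_algebra_derivative:
  fixes f :: "real^'n \<Rightarrow> real"
  shows "bump_algebra f \<Longrightarrow>
    \<exists>D. (\<forall>x. (f has_derivative D x) (at x)) \<and> (\<forall>j. bump_algebra (\<lambda>x. D x (axis j 1)))"
proof (induction rule: bump_algebra.induct)
  case (const c)
  show ?case by (rule exI[of _ "\<lambda>_ _. 0"]) (auto intro: bump_algebra.const)
next
  case (flat n a i b)
  let ?d = "\<lambda>y. flat_exp (n + 2) y - real n * flat_exp (n + 1) y"
  let ?D = "\<lambda>x v. ?d (a * x $ i + b) * (a * v $ i)"
  have "((\<lambda>x. flat_exp n (a * x $ i + b)) has_derivative ?D x) (at x)" for x :: "real^'n"
  proof -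
    have "((\<lambda>x::real^'n. a * x $ i + b) has_derivative (\<lambda>v. a * v $ i)) (at x)"
      by (auto intro!: derivative_eq_intros bounded_linear_imp_has_derivative bounded_linear_vec_nth)
    moreover have "(flat_exp n has_derivative (*) (?d (a * x $ i + b))) (at (a * x $ i + b))"
      using flat_exp_has_derivative by (simp add: has_field_derivative_def)
    ultimately show ?thesis
      using has_derivative_compose by blast
  qed
  moreover have "bump_algebra (\<lambda>x. ?D x (axis j 1))" for j
  proof -
    have "bump_algebra (\<lambda>x. (flat_exp (n + 2) (a * x $ i + b) +
        (- real n) * flat_exp (n + 1) (a * x $ i + b)) * (a * axis j 1 $ i))"
      by (intro bump_algebra.intros)
    then show ?thesis by simp
  qed
  ultimately show ?case by (intro exI[of _ ?D]) auto
next
  case (add f g)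
  then obtain D E where
    "\<And>x. (f has_derivative D x) (at x)" "\<And>j. bump_algebra (\<lambda>x. D x (axis j 1))"
    "\<And>x. (g has_derivative E x) (at x)" "\<And>j. bump_algebra (\<lambda>x. E x (axis j 1))"
    by blast
  then show ?case
    by (intro exI[of _ "\<lambda>x v. D x v + E x v"]) (auto intro!: has_derivative_add bump_algebra.add)
next
  case (mult f g)
  then obtain D E where
    "\<And>x. (f has_derivative D x) (at x)" "\<And>j. bump_algebra (\<lambda>x. D x (axis j 1))"
    "\<And>x. (g has_derivative E x) (at x)" "\<And>j. bump_algebra (\<lambda>x. E x (axis j 1))"
    by blast
  with mult.hyps show ?case
    by (intro exI[of _ "\<lambda>x v. f x * E x v + D x v * g x"])
      (auto intro!: has_derivative_mult bump_algebra.add bump_algebra.mult)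
next
  case (inverse f)
  then obtain D where
    D: "\<And>x. (f has_derivative D x) (at x)" "\<And>j. bump_algebra (\<lambda>x. D x (axis j 1))"
    by blast
  have "bump_algebra (\<lambda>x. (-1) * (inverse (f x) * D x (axis j 1) * inverse (f x)))" for j
    using inverse D by (intro bump_algebra.intros) auto
  then show ?case using inverse.hyps D(1)
    by (intro exI[of _ "\<lambda>x v. - (inverse (f x) * D x v * inverse (f x))"])
      (auto intro!: has_derivative_inverse)
qed

lemma bump_algebra_C_k: "bump_algebra f \<Longrightarrow> C_k k f"
proof (induction k arbitrary: f)
  case 0
  then obtain D where "\<And>x. (f has_derivative D x) (at x)"
    using bump_algebra_derivative by blast
  then show ?case
    by (auto intro!: continuous_at_imp_continuous_on has_derivative_continuous)
next
  case (Suc k)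
  then obtain D where D: "\<And>x. (f has_derivative D x) (at x)"
    "\<And>j. bump_algebra (\<lambda>x. D x (axis j 1))"
    using bump_algebra_derivative by blast
  have "partial_deriv j f = (\<lambda>x. D x (axis j 1))" for j
    by (rule ext) (simp add: partial_deriv_def frechet_derivative_at[OF D(1), symmetric])
  with D Suc.IH show ?case
    by (auto simp: differentiable_def)
qed

lemma bump_algebra_prod:
  assumes "finite I" "\<And>i. i \<in> I \<Longrightarrow> bump_algebra (f i)"
  shows "bump_algebra (\<lambda>x. \<Prod>i\<in>I. f i x)"
  using assms by (induction I rule: finite_induct) (auto intro: bump_algebra.intros)

lemma test_functions_approx_box:
  fixes a b :: "real^'n"
  assumes "box a b \<subseteq> U"
  obtains \<phi> :: "nat \<Rightarrow> real^'n \<Rightarrow> real"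
  where "\<And>n. \<phi> n \<in> test_functions U" "\<And>n x. \<bar>\<phi> n x\<bar> \<le> 1"
    "\<And>x. (\<lambda>n. \<phi> n x) \<longlonglongrightarrow> indicator (box a b) x"
proof -
  \<comment> \<open>The margin \<open>1 / Suc n\<close> makes the support a closed box inside the
    open one, hence compact; it shrinks to 0, so no point of the open box is lost in the
    limit.\<close>
  define \<psi> where "\<psi> n x = (\<Prod>i\<in>UNIV. flat_exp 0 (x $ i - a $ i - 1 / Suc n) *
    flat_exp 0 (b $ i - x $ i - 1 / Suc n))" for n and x :: "real^'n"
  \<comment> \<open>Where \<open>\<psi> n x\<close> has a positive limit, the factor
    \<open>n\<close> drives the denominator to infinity and the value to 1; off the box
    \<open>\<psi> n x\<close> is exactly 0.\<close>
  define \<phi> where "\<phi> n x = 1 - inverse (1 + real n * \<psi> n x)" for n x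
  have \<psi>_nonneg: "0 \<le> \<psi> n x" for n x
    by (simp add: \<psi>_def prod_nonneg flat_exp_nonneg)
  have pos: "1 + real n * \<psi> n x \<ge> 1" for n x
    using \<psi>_nonneg[of n x] by simp
  have \<psi>_bump: "bump_algebra (\<psi> n)" for n
  proof -
    have "bump_algebra (\<lambda>x::real^'n. \<Prod>i\<in>UNIV. flat_exp 0 (1 * x $ i + (- a $ i - 1 / Suc n)) *
        flat_exp 0 ((- 1) * x $ i + (b $ i - 1 / Suc n)))"
      by (intro bump_algebra_prod bump_algebra.intros) auto
    then show ?thesis by (simp add: \<psi>_def[abs_def] algebra_simps)
  qed
  have "bump_algebra (\<lambda>x. 1 + (-1) * inverse (1 + real n * \<psi> n x))" for n
    by (intro bump_algebra.intros \<psi>_bump) (use pos[of n] in \<open>smt (verit)\<close>)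
  then have \<phi>_bump: "bump_algebra (\<phi> n)" for n
    by (simp add: \<phi>_def[abs_def])
  have \<psi>_0: "\<psi> n x = 0"
    if "\<not> (\<forall>i. a $ i + 1 / Suc n < x $ i \<and> x $ i < b $ i - 1 / Suc n)" for n x
  proof -
    from that obtain i where "x $ i - a $ i - 1 / Suc n \<le> 0 \<or> b $ i - x $ i - 1 / Suc n \<le> 0"
      by (auto simp: not_less algebra_simps)
    then show ?thesis
      unfolding \<psi>_def by (intro prod_zero bexI[of _ i]) (auto simp: flat_exp_def)
  qed
  have "\<phi> n \<in> test_functions U" for n
  proof -
    let ?d = "vec (1 / Suc n) :: real^'n"
    let ?K = "cbox (a + ?d) (b - ?d)"
    have "?K \<subseteq> box a b"
    proof
      fix x assume x: "x \<in> ?K"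
      have "a $ i < x $ i \<and> x $ i < b $ i" for i
      proof -
        have "a $ i + 1 / Suc n \<le> x $ i" "x $ i \<le> b $ i - 1 / Suc n" "1 / real (Suc n) > 0"
          using x by (auto simp: mem_box_cart)
        then show ?thesis by linarith
      qed
      then show "x \<in> box a b" by (simp add: mem_box_cart)
    qed
    moreover have "\<phi> n x = 0" if "x \<notin> ?K" for x
    proof -
      have "\<not> (\<forall>i. a $ i + 1 / Suc n < x $ i \<and> x $ i < b $ i - 1 / Suc n)"
        using that by (force simp: mem_box_cart dest: less_imp_le)
      then show ?thesis using \<psi>_0[of n x] by (simp add: \<phi>_def)
    qed
    ultimately show ?thesis
      unfolding test_functions_def using \<phi>_bump[of n] bump_algebra_C_k assms
      by (auto intro!: exI[of _ ?K])
  qed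
  moreover have "\<bar>\<phi> n x\<bar> \<le> 1" for n x
    using pos[of n x] le_imp_inverse_le[OF pos[of n x]]
    by (auto simp: \<phi>_def abs_le_iff intro: order_trans[of _ 0])
  moreover have "(\<lambda>n. \<phi> n x) \<longlonglongrightarrow> indicator (box a b) x" for x
  proof (cases "x \<in> box a b")
    case False
    have "\<psi> n x = 0" for n
    proof (rule \<psi>_0, rule notI)
      assume *: "\<forall>i. a $ i + 1 / real (Suc n) < x $ i \<and> x $ i < b $ i - 1 / real (Suc n)"
      have "a $ i < x $ i \<and> x $ i < b $ i" for i
        using *[rule_format, of i] by (smt (verit) divide_nonneg_nonneg of_nat_0_le_iff)
      with False show False by (simp add: mem_box_cart)
    qed
    with False show ?thesis by (simp add: \<phi>_def)
  next
    case True
    let ?L = "\<Prod>i\<in>UNIV. flat_exp 0 (x $ i - a $ i) * flat_exp 0 (b $ i - x $ i)"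
    have cont: "isCont (flat_exp 0) y" for y
      using flat_exp_has_derivative DERIV_isCont by blast
    have lim: "(\<lambda>n. c - 1 / real (Suc n)) \<longlonglongrightarrow> c" for c
      using tendsto_diff[OF tendsto_const[of c] LIMSEQ_Suc[OF lim_1_over_n]] by simp
    have "(\<lambda>n. \<psi> n x) \<longlonglongrightarrow> ?L"
      unfolding \<psi>_def by (intro tendsto_prod tendsto_mult isCont_tendsto_compose[OF cont] lim)
    moreover have "0 < flat_exp 0 y" if "0 < y" for y
      using that by (simp add: flat_exp_def)
    then have "?L > 0"
      using True by (intro prod_pos ballI mult_pos_pos) (auto simp: mem_box_cart)
    ultimately have "filterlim (\<lambda>n. \<psi> n x * real n) at_top sequentially"
      using filterlim_real_sequentially by (rule filterlim_tendsto_pos_mult_at_top)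
    then have "filterlim (\<lambda>n. 1 + real n * \<psi> n x) at_top sequentially"
      by (intro filterlim_tendsto_add_at_top[OF tendsto_const]) (simp add: mult.commute)
    then have "(\<lambda>n. inverse (1 + real n * \<psi> n x)) \<longlonglongrightarrow> 0"
      by (intro tendsto_inverse_0_at_top)
    then have "(\<lambda>n. \<phi> n x) \<longlonglongrightarrow> 1 - 0"
      unfolding \<phi>_def by (intro tendsto_diff tendsto_const)
    with True show ?thesis by simp
  qed
  ultimately show ?thesis using that by blast
qed

section \<open>Signed measures and test functions\<close>

text \<open>Dynkin's argument: the sets where \<open>d\<close> vanishes are closed under complements
  and disjoint unions and contain the intersection-stable boxes. It is phrased for a countably
  additive set function because \<open>d\<close> will be a difference of measures and of the
  integral of a signed density.\<close>

lemma signed_set_function_eq_0: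
  fixes d :: "'a::euclidean_space set \<Rightarrow> real"
  assumes sums: "\<And>A. range A \<subseteq> sets borel \<Longrightarrow> disjoint_family A \<Longrightarrow>
      (\<lambda>i::nat. d (A i)) sums d (\<Union>i. A i)"
    and box: "\<And>a b. d (box a b) = 0" and UNIV: "d UNIV = 0" and E: "E \<in> sets borel"
  shows "d E = 0"
proof -
  let ?G = "range (\<lambda>(a, b). box a b :: 'a set)"
  have borel: "sets borel = sigma_sets UNIV ?G"
    unfolding borel_eq_box by (rule sets_measure_of) simp
  have Int: "Int_stable ?G"
  proof (rule Int_stableI_image)
    fix p q :: "'a \<times> 'a"
    have "\<exists>r. (case p of (a, b) \<Rightarrow> box a b) \<inter> (case q of (a, b) \<Rightarrow> box a b) =
        (case r of (a, b) \<Rightarrow> box a b)"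
      by (cases p; cases q; simp add: box_Int_box) blast
    then show "\<exists>r\<in>UNIV. (case p of (a, b) \<Rightarrow> box a b) \<inter> (case q of (a, b) \<Rightarrow> box a b) =
        (case r of (a, b) \<Rightarrow> box a b)" by simp
  qed
  have subset_Pow_UNIV: "?G \<subseteq> Pow UNIV" by simp
  have empty: "d {} = 0"
    using box[of 0 0] by simp
  show ?thesis
    using Int subset_Pow_UNIV E[unfolded borel]
  proof (induction rule: sigma_sets_induct_disjoint)
    case (basic A)
    then show ?case using box by auto
  next
    case (compl A)
    \<comment> \<open>Padding with empty sets extracts finite additivity from countable
      additivity.\<close>
    let ?A = "\<lambda>i::nat. if i = 0 then A else if i = 1 then UNIV - A else {}"
    have "range ?A \<subseteq> sets borel"
      using compl by (auto simp: borel[symmetric])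
    moreover have "disjoint_family ?A"
      by (auto simp: disjoint_family_on_def)
    ultimately have "(\<lambda>i. d (?A i)) sums d (\<Union>i. ?A i)"
      by (rule sums)
    moreover have "(\<Union>i. ?A i) = UNIV"
    proof -
      have "x \<in> ?A 0 \<or> x \<in> ?A 1" for x by simp
      then show ?thesis by blast
    qed
    moreover have "(\<lambda>i. d (?A i)) sums (\<Sum>i<2. d (?A i))"
      by (rule sums_finite) (auto simp: empty)
    ultimately have "d UNIV = (\<Sum>i<2. d (?A i))"
      by (simp only: sums_unique2)
    then have "d UNIV = d A + d (UNIV - A)"
      unfolding lessThan_nat_numeral pred_numeral_simps by simp
    with compl UNIV show ?case by simp
  next
    case (union A)
    then have "(\<lambda>i. d (A i)) sums d (\<Union>i. A i)"
      unfolding borel[symmetric] by (intro sums)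
    then have "(\<lambda>i. 0) sums d (\<Union>i. A i)"
      unfolding union.IH .
    then show ?case
      by (rule sums_unique2[OF _ sums_zero])
  qed (auto simp: empty)
qed

lemma finite_borel_on_space: "finite_borel_on U M \<Longrightarrow> U \<in> sets borel \<Longrightarrow> space M = U"
  using sets_eq_imp_space_eq[of M "restrict_space borel U"]
  by (simp add: finite_borel_on_def space_restrict_space)

lemma finite_borel_on_sets:
  "finite_borel_on U M \<Longrightarrow> U \<in> sets borel \<Longrightarrow> E \<in> sets borel \<Longrightarrow> U \<inter> E \<in> sets M"
  by (auto simp: finite_borel_on_def sets_restrict_space)

lemma finite_borel_on_measurable:
  assumes "finite_borel_on U M" "f \<in> borel_measurable borel"
  shows "f \<in> borel_measurable M"
proof -
  have "sets M = sets (restrict_space borel U)"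
    using assms(1) by (simp add: finite_borel_on_def)
  then show ?thesis
    using measurable_restrict_space1[OF assms(2), of U] by (simp cong: measurable_cong_sets)
qed

lemma test_functions_measurable:
  "\<phi> \<in> test_functions U \<Longrightarrow> \<phi> \<in> borel_measurable borel"
  by (auto simp: test_functions_def intro!: borel_measurable_continuous_onI dest: spec[of _ 0])

lemma finite_borel_on_measure_sums:
  fixes A :: "nat \<Rightarrow> (real^'n) set"
  assumes "finite_borel_on U M" "U \<in> sets borel" "range A \<subseteq> sets borel" "disjoint_family A"
  shows "(\<lambda>i. measure M (U \<inter> A i)) sums measure M (U \<inter> (\<Union>i. A i))"
proof -
  interpret finite_measure M
    using assms(1) by (simp add: finite_borel_on_def)
  have "U \<inter> A i \<in> sets M" for i
    using assms by (intro finite_borel_on_sets) auto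
  then have "(\<lambda>i. measure M (U \<inter> A i)) sums measure M (\<Union>i. U \<inter> A i)"
    using disjoint_family_subset[OF assms(4), of "\<lambda>i. U \<inter> A i"]
    by (intro finite_measure_UNION) auto
  then show ?thesis by simp
qed

lemma set_integral_sums:
  fixes v :: "_ \<Rightarrow> real"
  assumes v: "set_integrable M U v" and "\<And>i::nat. U \<inter> A i \<in> sets M" and "disjoint_family A"
    "(\<Union>i. U \<inter> A i) \<in> sets M"
  shows "(\<lambda>i. LINT x:U \<inter> A i|M. v x) sums (LINT x:U \<inter> (\<Union>i. A i)|M. v x)"
proof -
  have int: "set_integrable M (U \<inter> B) v" if "U \<inter> B \<in> sets M" for B
    using v that by (rule set_integrable_subset) auto
  have eq: "(\<lambda>n. LINT x:U \<inter> (\<Union>i<n. A i)|M. v x) = (\<lambda>n. \<Sum>i<n. LINT x:U \<inter> A i|M. v x)"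
  proof
    fix n
    have "(LINT x:(\<Union>i<n. U \<inter> A i)|M. v x) = (\<Sum>i<n. LINT x:U \<inter> A i|M. v x)"
      by (rule set_integral_finite_Union)
        (use assms int in \<open>auto simp: disjoint_family_on_def\<close>)
    then show "(LINT x:U \<inter> (\<Union>i<n. A i)|M. v x) = (\<Sum>i<n. LINT x:U \<inter> A i|M. v x)" by simp
  qed
  have UN: "U \<inter> (\<Union>i<n. A i) \<in> sets M" for n
  proof -
    have "(\<Union>i<n. U \<inter> A i) \<in> sets M"
      using assms(2) by (intro sets.finite_UN) auto
    moreover have "(\<Union>i<n. U \<inter> A i) = U \<inter> (\<Union>i<n. A i)" by blast
    ultimately show ?thesis by simp
  qed
  have eq': "(\<Union>n. U \<inter> (\<Union>i<n. A i)) = U \<inter> (\<Union>i. A i)" by auto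
  have "(\<lambda>n. LINT x:U \<inter> (\<Union>i<n. A i)|M. v x) \<longlonglongrightarrow> (LINT x:(\<Union>n. U \<inter> (\<Union>i<n. A i))|M. v x)"
  proof (rule set_integral_cont_up)
    show "incseq (\<lambda>n. U \<inter> (\<Union>i<n. A i))" by (force simp: incseq_def)
    show "set_integrable M (\<Union>n. U \<inter> (\<Union>i<n. A i)) v"
      unfolding eq' using assms(4) int by simp
  qed (rule UN)
  then show ?thesis unfolding eq' by (simp add: sums_def eq)
qed

lemma integral_tendsto_measure:
  assumes M: "finite_borel_on U M" "U \<in> sets borel" and \<phi>: "\<And>n. \<phi> n \<in> borel_measurable borel"
    "\<And>n x. \<bar>\<phi> n x\<bar> \<le> 1" "\<And>x. (\<lambda>n. \<phi> n x) \<longlonglongrightarrow> indicator B x" and B: "B \<in> sets borel"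
  shows "(\<lambda>n. LINT x|M. \<phi> n x) \<longlonglongrightarrow> measure M (U \<inter> B)"
proof -
  interpret finite_measure M
    using M(1) by (simp add: finite_borel_on_def)
  have "\<phi> n \<in> borel_measurable M" for n
    by (rule finite_borel_on_measurable[OF M(1) \<phi>(1)])
  moreover have "indicator B \<in> borel_measurable M"
    by (rule finite_borel_on_measurable[OF M(1)]) (use B in simp)
  ultimately have "(\<lambda>n. LINT x|M. \<phi> n x) \<longlonglongrightarrow> (LINT x|M. indicator B x)"
    using \<phi>(2,3) by (intro integral_dominated_convergence[of _ _ _ "\<lambda>_. 1"]) auto
  then show ?thesis
    using finite_borel_on_space[OF M] by (simp add: Int_commute)
qed

text \<open>Test functions converge boundedly to indicators of boxes, and boxes generate the Borel sets.\<close>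

lemma signed_measure_eq_density:
  fixes c d :: "real^'n"
  defines "U \<equiv> box c d"
  assumes P: "finite_borel_on U P" and N: "finite_borel_on U N" and v: "set_integrable lebesgue U v"
    and eq: "\<And>\<phi>. \<phi> \<in> test_functions U \<Longrightarrow>
      (LINT x|P. \<phi> x) - (LINT x|N. \<phi> x) = (LINT x:U|lebesgue. \<phi> x * v x)"
    and E: "E \<in> sets borel"
  shows "measure P (U \<inter> E) - measure N (U \<inter> E) = (LINT x:U \<inter> E|lebesgue. v x)"
proof -
  define D where "D E = measure P (U \<inter> E) - measure N (U \<inter> E) - (LINT x:U \<inter> E|lebesgue. v x)" for E
  have U: "U \<in> sets borel" by (simp add: U_def)
  have box: "D (box a b) = 0" for a b
  proof -
    have sub: "U \<inter> box a b \<subseteq> U" by simp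
    \<comment> \<open>Since \<open>U\<close> is a box, its trace on a box is again a box and can be
      approximated by test functions on \<open>U\<close>.\<close>
    obtain a' b' where ab: "U \<inter> box a b = box a' b'"
      unfolding U_def box_Int_box by blast
    obtain \<phi> :: "nat \<Rightarrow> real^'n \<Rightarrow> real" where \<phi>: "\<And>n. \<phi> n \<in> test_functions U" "\<And>n x. \<bar>\<phi> n x\<bar> \<le> 1"
      "\<And>x. (\<lambda>n. \<phi> n x) \<longlonglongrightarrow> indicator (U \<inter> box a b) x"
      using test_functions_approx_box[OF sub[unfolded ab]] unfolding ab by blast
    note meas = test_functions_measurable[OF \<phi>(1)]
    have "(\<lambda>n. (LINT x|P. \<phi> n x) - (LINT x|N. \<phi> n x)) \<longlonglongrightarrow>
        measure P (U \<inter> (U \<inter> box a b)) - measure N (U \<inter> (U \<inter> box a b))"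
      using U by (intro tendsto_diff integral_tendsto_measure P N U meas \<phi>) auto
    moreover have "(\<lambda>n. LINT x:U|lebesgue. \<phi> n x * v x) \<longlonglongrightarrow> (LINT x:U \<inter> box a b|lebesgue. v x)"
      unfolding set_lebesgue_integral_def
    proof (rule integral_dominated_convergence[of _ _ _ "\<lambda>x. \<bar>indicator U x *\<^sub>R v x\<bar>"])
      have ind: "(\<lambda>x. indicator U x *\<^sub>R v x) \<in> borel_measurable lebesgue"
        using v by (auto simp: set_integrable_def)
      show "integrable lebesgue (\<lambda>x. \<bar>indicator U x *\<^sub>R v x\<bar>)"
        using v by (auto simp: set_integrable_def)
      have "(\<lambda>x. indicator (box a b) x * (indicator U x *\<^sub>R v x)) \<in> borel_measurable lebesgue"
        using ind by (intro borel_measurable_times) (auto intro!: borel_measurable_indicator)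
      then show "(\<lambda>x. indicator (U \<inter> box a b) x *\<^sub>R v x) \<in> borel_measurable lebesgue"
        by (simp add: indicator_inter_arith mult_ac)
      fix n
      have "\<phi> n \<in> borel_measurable lebesgue"
        using meas[of n] by (intro measurable_completion) simp
      then have "(\<lambda>x. \<phi> n x * (indicator U x *\<^sub>R v x)) \<in> borel_measurable lebesgue"
        using ind by (intro borel_measurable_times)
      then show "(\<lambda>x. indicator U x *\<^sub>R (\<phi> n x * v x)) \<in> borel_measurable lebesgue"
        by (simp add: mult_ac)
      show "AE x in lebesgue. norm (indicator U x *\<^sub>R (\<phi> n x * v x)) \<le> \<bar>indicator U x *\<^sub>R v x\<bar>"
        using \<phi>(2) by (auto simp: abs_mult indicator_def intro!: mult_left_le_one_le)
    next
      show "AE x in lebesgue. (\<lambda>n. indicator U x *\<^sub>R (\<phi> n x * v x))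
          \<longlonglongrightarrow> indicator (U \<inter> box a b) x *\<^sub>R v x"
      proof (intro AE_I2)
        fix x
        have "(\<lambda>n. \<phi> n x * (indicator U x *\<^sub>R v x)) \<longlonglongrightarrow>
          indicator (U \<inter> box a b) x * (indicator U x *\<^sub>R v x)"
          by (intro tendsto_intros \<phi>)
        then show "(\<lambda>n. indicator U x *\<^sub>R (\<phi> n x * v x))
          \<longlonglongrightarrow> indicator (U \<inter> box a b) x *\<^sub>R v x"
          by (auto simp: indicator_def)
      qed
    qed
    ultimately have "measure P (U \<inter> (U \<inter> box a b)) - measure N (U \<inter> (U \<inter> box a b)) =
        (LINT x:U \<inter> box a b|lebesgue. v x)"
      unfolding eq[OF \<phi>(1)] by (rule LIMSEQ_unique)
    then show ?thesis by (simp add: D_def)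
  qed
  have "D E = 0"
  proof (rule signed_set_function_eq_0[where d = D and E = E, OF _ box _ E])
    \<comment> \<open>\<open>D\<close> sees only the part of a set inside \<open>U\<close>, and
      \<open>U\<close> is itself the box from \<open>c\<close> to \<open>d\<close>.\<close>
    show "D UNIV = 0"
      using box[of c d] by (simp add: D_def U_def)
    fix A :: "nat \<Rightarrow> (real^'n) set"
    assume A: "range A \<subseteq> sets borel" "disjoint_family A"
    then have "U \<inter> A i \<in> sets lebesgue" for i
      using U by (auto intro!: sets_completionI_sets)
    moreover have "(\<Union>i. U \<inter> A i) \<in> sets lebesgue"
      using A(1) U by (auto intro!: sets_completionI_sets)
    ultimately show "(\<lambda>i. D (A i)) sums D (\<Union>i. A i)"
      unfolding D_def
      by (intro sums_diff finite_borel_on_measure_sums set_integral_sums P N v U A)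
  qed
  then show ?thesis by (simp add: D_def)
qed

section \<open>Weak partial derivatives on the square\<close>

text \<open>The first argument is the coordinate in direction \<open>j\<close>, the second the other
  coordinate, so that one lemma with parameter \<open>j\<close> covers both partial
  derivatives.\<close>

definition line :: "2 \<Rightarrow> real \<Rightarrow> real \<Rightarrow> real^2" where
  "line j a b = (\<chi> i. if i = j then a else b)"

lemma line_nth [simp]: "line 1 a b $ 1 = a" "line 1 a b $ 2 = b"
  "line 2 a b $ 1 = b" "line 2 a b $ 2 = a" "line j a b $ j = a"
  by (simp_all add: line_def)

lemma line_eq: "line j a b = a *\<^sub>R axis j 1 + b *\<^sub>R (1 - axis j 1)"
  by (auto simp: line_def vec_eq_iff axis_def)

lemma line_add: "line j a b = line j c b + (a - c) *\<^sub>R axis j 1"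
  by (auto simp: line_def vec_eq_iff axis_def)

lemma line_measurable [measurable]:
  "(\<lambda>(a, b). line j a b) \<in> borel_measurable (lborel \<Otimes>\<^sub>M lborel)"
proof -
  have "(\<lambda>p. fst p *\<^sub>R (axis j 1 :: real^2) + snd p *\<^sub>R (1 - axis j 1)) \<in>
      borel_measurable (borel :: (real \<times> real) measure)"
    by (intro borel_measurable_continuous_onI continuous_intros)
  then show ?thesis
    by (simp add: line_eq[abs_def] case_prod_beta' lborel_prod)
qed

lemma continuous_on_line: "continuous_on S (\<lambda>a. line j a b)" "continuous_on S (\<lambda>b. line j a b)"
  by (auto simp: line_eq intro!: continuous_intros)

lemma line_measurable1 [measurable]: "(\<lambda>a. line j a b) \<in> borel_measurable borel"
  and line_measurable2 [measurable]: "(\<lambda>b. line j a b) \<in> borel_measurable borel"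
  by (auto intro!: borel_measurable_continuous_onI continuous_on_line)

section \<open>The square and Fubini along coordinate lines\<close>

lemma open_square_iff: "x \<in> open_square \<longleftrightarrow> x $ 1 \<in> {-1<..<1} \<and> x $ 2 \<in> {-1<..<1}"
  by (auto simp: open_square_def mem_box_cart forall_2)

lemma closed_square_iff: "x \<in> closed_square \<longleftrightarrow> x $ 1 \<in> {-1..1} \<and> x $ 2 \<in> {-1..1}"
  by (auto simp: closed_square_def mem_box_cart forall_2)

lemma line_in_open_square [simp]:
  "line j a b \<in> open_square \<longleftrightarrow> a \<in> {-1<..<1} \<and> b \<in> {-1<..<1}"
  using exhaust_2[of j] by (auto simp: open_square_iff)

lemma line_in_closed_square [simp]:
  "line j a b \<in> closed_square \<longleftrightarrow> a \<in> {-1..1} \<and> b \<in> {-1..1}"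
  using exhaust_2[of j] by (auto simp: closed_square_iff)

lemma indicator_open_square_line:
  "indicator open_square (line j a b) = indicator {-1<..<1} a * (indicator {-1<..<1} b :: real)"
  by (auto simp: indicator_def)

lemma open_square_borel [measurable]: "open_square \<in> sets borel"
  by (simp add: open_square_def)

text \<open>Lebesgue measure is determined by its values on boxes. The identity carries Fubini over
  from pairs of reals to \<open>real^2\<close>.\<close>

lemma lborel_eq_distr_line: "lborel = distr (lborel \<Otimes>\<^sub>M lborel) borel (\<lambda>(a, b). line j a b)"
proof (rule lborel_eqI)
  fix l u :: "real^2"
  assume lu: "\<And>b. b \<in> Basis \<Longrightarrow> l \<bullet> b \<le> u \<bullet> b"
  have Basis: "(Basis :: (real^2) set) = {axis 1 1, axis 2 1}"
    by (auto simp: Basis_vec_def UNIV_2)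
  have le: "l $ 1 \<le> u $ 1" "l $ 2 \<le> u $ 2"
    using lu[of "axis 1 1"] lu[of "axis 2 1"] by (auto simp: Basis cart_eq_inner_axis)
  have ne: "axis 1 1 \<noteq> (axis 2 1 :: real^2)"
    by (simp add: axis_eq_axis)
  \<comment> \<open>\<open>k\<close> is the index other than \<open>j\<close>.\<close>
  obtain k where k: "k \<noteq> j" "\<And>i. i = j \<or> i = k"
    using exhaust_2 by (metis (full_types) zero_neq_one)
  have "(\<lambda>(a, b). line j a b) -` box l u \<inter> space (lborel \<Otimes>\<^sub>M lborel)
      = {l $ j<..<u $ j} \<times> {l $ k<..<u $ k}"
  proof -
    have "(\<forall>i. Q i) \<longleftrightarrow> Q j \<and> Q k" for Q
      using k(2) by metis
    then have "line j a b \<in> box l u \<longleftrightarrow> a \<in> {l $ j<..<u $ j} \<and> b \<in> {l $ k<..<u $ k}" for a b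
      unfolding mem_box_cart using k(1) by (simp only: line_def vec_lambda_beta) simp
    then show ?thesis
      by (auto simp: space_pair_measure)
  qed
  then have "emeasure (distr (lborel \<Otimes>\<^sub>M lborel) borel (\<lambda>(a, b). line j a b)) (box l u)
      = ennreal (u $ j - l $ j) * ennreal (u $ k - l $ k)"
    using le k exhaust_2[of j] exhaust_2[of k]
    by (auto simp: emeasure_distr lborel.emeasure_pair_measure_Times)
  also have "\<dots> = ennreal (u $ 1 - l $ 1) * ennreal (u $ 2 - l $ 2)"
    using k exhaust_2[of j] exhaust_2[of k] by (auto simp: mult.commute)
  also have "\<dots> = (\<Prod>b\<in>Basis. (u - l) \<bullet> b)"
    using le ne by (simp add: Basis ennreal_mult cart_eq_inner_axis inner_diff_left)
  finally show "emeasure (distr (lborel \<Otimes>\<^sub>M lborel) borel (\<lambda>(a, b). line j a b)) (box l u)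
      = (\<Prod>b\<in>Basis. (u - l) \<bullet> b)" .
qed simp

lemma integral_line:
  fixes g :: "real^2 \<Rightarrow> real"
  assumes "integrable lborel g"
  shows "(LINT x|lborel. g x) = (LINT b|lborel. LINT a|lborel. g (line j a b))"
proof -
  have g: "g \<in> borel_measurable borel"
    using borel_measurable_integrable[OF assms] by simp
  then have "integrable (lborel \<Otimes>\<^sub>M lborel) (\<lambda>p. g (case p of (a, b) \<Rightarrow> line j a b))"
    using assms integrable_distr_eq[OF line_measurable g, of j]
    by (simp flip: lborel_eq_distr_line)
  then have "integrable (lborel \<Otimes>\<^sub>M lborel) (\<lambda>(a, b). g (line j a b))"
    by (simp add: case_prod_beta')
  moreover have "(LINT x|lborel. g x) = (LINT p|(lborel \<Otimes>\<^sub>M lborel). g (case p of (a, b) \<Rightarrow> line j a b))"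
    using integral_distr[OF line_measurable g, of j] by (simp flip: lborel_eq_distr_line)
  ultimately show ?thesis
    by (simp add: lborel_pair.integral_snd case_prod_beta')
qed

text \<open>Fubini for null sets, by vertical sections. The Luzin condition uses both directions: to
  cut a null set into null sections, and to reassemble the images of the sections.\<close>

lemma null_sets_line:
  assumes W: "W \<in> sets borel"
  shows "W \<in> null_sets lborel \<longleftrightarrow> (AE a in lborel. {b. line 1 a b \<in> W} \<in> null_sets lborel)"
proof -
  have meas: "(\<lambda>(a, b). line 1 a b) -` W \<inter> space (lborel \<Otimes>\<^sub>M lborel) \<in> sets (lborel \<Otimes>\<^sub>M lborel)"
    using W by (intro measurable_sets[OF line_measurable])
  have sec: "{b. line 1 a b \<in> W} \<in> sets lborel" for a
    using measurable_sets[OF line_measurable2 W, of 1 a] by (simp add: vimage_def)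
  have "W \<in> null_sets lborel \<longleftrightarrow> emeasure (distr (lborel \<Otimes>\<^sub>M lborel) borel (\<lambda>(a, b). line 1 a b)) W = 0"
    using W by (subst lborel_eq_distr_line[of 1]) (auto simp: null_sets_def)
  also have "\<dots> \<longleftrightarrow> (\<lambda>(a, b). line 1 a b) -` W \<inter> space (lborel \<Otimes>\<^sub>M lborel) \<in> null_sets (lborel \<Otimes>\<^sub>M lborel)"
    using W meas by (simp add: emeasure_distr null_sets_def)
  also have "\<dots> \<longleftrightarrow> (AE p in lborel \<Otimes>\<^sub>M lborel. line 1 (fst p) (snd p) \<notin> W)"
    by (subst AE_iff_null_sets[OF meas]) (simp add: case_prod_beta space_pair_measure)
  also have "\<dots> \<longleftrightarrow> (AE a in lborel. AE b in lborel. line 1 a b \<notin> W)"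
  proof (rule lborel_pair.AE_pair_iff[symmetric])
    have "{x \<in> space (lborel \<Otimes>\<^sub>M lborel). line 1 (fst x) (snd x) \<notin> W} =
        space (lborel \<Otimes>\<^sub>M lborel) - (\<lambda>(a, b). line 1 a b) -` W \<inter> space (lborel \<Otimes>\<^sub>M lborel)"
      by auto
    then show "{x \<in> space (lborel \<Otimes>\<^sub>M lborel). line 1 (fst x) (snd x) \<notin> W} \<in> sets (lborel \<Otimes>\<^sub>M lborel)"
      using meas by (metis sets.Diff sets.top)
  qed
  also have "\<dots> \<longleftrightarrow> (AE a in lborel. {b. line 1 a b \<in> W} \<in> null_sets lborel)"
    using AE_iff_null_sets[OF sec] by simp
  finally show ?thesis .
qed

lemma set_integrable_bounded:
  fixes g :: "'a::euclidean_space \<Rightarrow> real"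
  assumes g: "g \<in> borel_measurable borel" and b: "\<And>x. x \<in> U \<Longrightarrow> \<bar>g x\<bar> \<le> C"
    and U: "U \<in> sets borel" "bounded U"
  shows "set_integrable lborel U g"
  unfolding set_integrable_def
proof (rule integrableI_bounded_set[of U _ _ C])
  show "emeasure lborel U < \<infinity>"
    using U(2) by (rule emeasure_bounded_finite)
  have "norm (indicator U x *\<^sub>R g x) \<le> C" if "x \<in> U" for x
    using b[OF that] that by simp
  then show "AE x in lborel. x \<in> U \<longrightarrow> norm (indicator U x *\<^sub>R g x) \<le> C"
    by auto
qed (use g U in \<open>auto\<close>)

text \<open>The definitions integrate against \<open>lebesgue\<close>, while Fubini works with
  \<open>lborel\<close>; this is the bridge for Borel functions.\<close>

lemma set_integrable_lebesgue_iff: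
  fixes g :: "'a::euclidean_space \<Rightarrow> real"
  assumes "g \<in> borel_measurable borel" "U \<in> sets borel"
  shows "set_integrable lebesgue U g \<longleftrightarrow> set_integrable lborel U g"
    and "(LINT x:U|lebesgue. g x) = (LINT x:U|lborel. g x)"
  unfolding set_integrable_def set_lebesgue_integral_def
  using assms by (auto intro!: integrable_completion integral_completion)

lemma bounded_open_square: "bounded open_square"
  by (simp add: open_square_def)

lemma set_integral_open_square:
  fixes g :: "real^2 \<Rightarrow> real"
  assumes g: "g \<in> borel_measurable borel" and b: "\<And>x. x \<in> open_square \<Longrightarrow> \<bar>g x\<bar> \<le> C"
  shows "(LINT x:open_square|lebesgue. g x) =
    (LINT b:{-1<..<1}|lborel. LINT a:{-1<..<1}|lborel. g (line j a b))"
proof -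
  have "(LINT x:open_square|lebesgue. g x) = (LINT x:open_square|lborel. g x)"
    using g by (intro set_integrable_lebesgue_iff) auto
  also have "\<dots> = (LINT b|lborel. LINT a|lborel. indicator open_square (line j a b) *\<^sub>R g (line j a b))"
    using set_integrable_bounded[OF g b open_square_borel bounded_open_square]
    unfolding set_integrable_def set_lebesgue_integral_def by (rule integral_line)
  also have "\<dots> = (LINT b:{-1<..<1}|lborel. LINT a:{-1<..<1}|lborel. g (line j a b))"
    unfolding set_lebesgue_integral_def indicator_open_square_line
    by (intro Bochner_Integration.integral_cong refl)
      (simp add: mult.assoc mult.left_commute flip: integral_mult_right_zero)
  finally show ?thesis .
qed

section \<open>Integration by parts on coordinate lines\<close>

lemma test_function_props:
  assumes "\<phi> \<in> test_functions open_square"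
  shows "continuous_on UNIV \<phi>" "continuous_on UNIV (partial_deriv j \<phi>)"
    "((\<lambda>a. \<phi> (line j a b)) has_real_derivative partial_deriv j \<phi> (line j a b)) (at a)"
    "x \<notin> open_square \<Longrightarrow> \<phi> x = 0"
proof -
  have C: "C_k k \<phi>" for k
    using assms by (auto simp: test_functions_def)
  show "continuous_on UNIV \<phi>"
    using C[of 0] by simp
  have C1: "(\<forall>x. \<phi> differentiable (at x)) \<and> (\<forall>j. C_k 0 (partial_deriv j \<phi>))"
    using C[of "Suc 0"] by simp
  then show "continuous_on UNIV (partial_deriv j \<phi>)" by simp
  let ?D = "frechet_derivative \<phi> (at (line j a b))"
  have \<phi>: "(\<phi> has_derivative ?D) (at (line j a b))"
    using C1 frechet_derivative_works by blast
  have lin: "((\<lambda>a. line j a b) has_derivative (\<lambda>h. h *\<^sub>R axis j 1)) (at a)"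
    by (subst line_add[of _ _ _ 0]) (auto intro!: derivative_eq_intros)
  have "((\<lambda>a. \<phi> (line j a b)) has_derivative (\<lambda>h. ?D (h *\<^sub>R axis j 1))) (at a)"
    using has_derivative_compose[OF lin \<phi>] .
  then have "((\<lambda>a. \<phi> (line j a b)) has_derivative (\<lambda>h. h *\<^sub>R ?D (axis j 1))) (at a)"
    using has_derivative_bounded_linear[OF \<phi>] linear_simps(5) by (metis (no_types, lifting) ext)
  then show "((\<lambda>a. \<phi> (line j a b)) has_real_derivative partial_deriv j \<phi> (line j a b)) (at a)"
    by (simp add: has_field_derivative_def partial_deriv_def mult_commute_abs)
  show "x \<notin> open_square \<Longrightarrow> \<phi> x = 0"
    using assms by (auto simp: test_functions_def)
qed

lemma continuous_bounded_on_open_square: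
  fixes g :: "real^2 \<Rightarrow> real"
  assumes "continuous_on UNIV g"
  obtains C where "C \<ge> 0" "\<And>x. x \<in> closed_square \<Longrightarrow> \<bar>g x\<bar> \<le> C"
proof -
  have "compact (g ` closed_square)"
    using assms by (intro compact_continuous_image)
      (auto simp: closed_square_def intro: continuous_on_subset)
  then obtain C where "\<forall>y\<in>g ` closed_square. norm y \<le> C"
    using compact_imp_bounded bounded_iff by metis
  then show ?thesis using that[of "max C 0"] by (auto simp: le_max_iff_disj)
qed

lemma open_subset_closed_square: "open_square \<subseteq> closed_square"
  by (auto simp: open_square_iff closed_square_iff)

lemma set_integral_Ioo_eq_Icc:
  fixes f :: "real \<Rightarrow> real"
  assumes "a \<le> b"
  shows "(LINT x:{a<..<b}|lborel. f x) = (LINT x:{a..b}|lborel. f x)"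
  using interval_integral_Icc[of a b f] interval_integral_Ioo[of a b f] assms by simp

lemma integral_by_parts_compact_support:
  fixes u v p p' :: "real \<Rightarrow> real"
  assumes u: "\<And>x. x \<in> {-1..1} \<Longrightarrow> (u has_real_derivative v x) (at x within {-1..1})"
    and p: "\<And>x. x \<in> {-1..1} \<Longrightarrow> (p has_real_derivative p' x) (at x within {-1..1})"
    and cont: "continuous_on {-1..1} v" "continuous_on {-1..1} p'"
    and bd: "p (-1) = 0" "p 1 = 0"
  shows "(LINT x:{-1<..<1}|lborel. u x * p' x) = - (LINT x:{-1<..<1}|lborel. p x * v x)"
proof -
  have c: "continuous_on {-1..1} u" "continuous_on {-1..1} p"
    using u p DERIV_continuous_on by blast+
  have "(LBINT x=ereal (-1)..ereal 1. u x * p' x + p x * v x) = u 1 * p 1 - u (-1) * p (-1)"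
  proof (rule interval_integral_FTC_finite)
    fix x :: real
    assume "min (-1) 1 \<le> x" "x \<le> max (-1) 1"
    then show "((\<lambda>x. u x * p x) has_vector_derivative u x * p' x + p x * v x)
        (at x within {min (-1) 1..max (-1) 1})"
      using u[of x] p[of x]
      by (auto intro!: derivative_eq_intros simp flip: has_real_derivative_iff_has_vector_derivative)
  qed (use c cont in \<open>auto intro!: continuous_intros\<close>)
  then have "(LINT x:{-1..1}|lborel. u x * p' x + p x * v x) = 0"
    using bd interval_integral_Icc[of "-1" 1 "\<lambda>x. u x * p' x + p x * v x"] by simp
  moreover have "set_integrable lborel {-1..1} (\<lambda>x. u x * p' x)"
    "set_integrable lborel {-1..1} (\<lambda>x. p x * v x)"
    using c cont by (auto intro!: borel_integrable_atLeastAtMost' continuous_intros)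
  ultimately show ?thesis
    by (simp add: set_integral_Ioo_eq_Icc set_integral_add)
qed

text \<open>The identity common to \<open>sobolev_map\<close> and to
  \<open>distr_deriv_measure\<close> for a measure with density \<open>v\<close>; integrability of
  \<open>v\<close> is kept apart.\<close>

definition weak_partial_deriv :: "2 \<Rightarrow> (real^2 \<Rightarrow> real) \<Rightarrow> (real^2 \<Rightarrow> real) \<Rightarrow> bool" where
  "weak_partial_deriv j u v \<longleftrightarrow> (\<forall>\<phi>\<in>test_functions open_square.
     (LINT x:open_square|lebesgue. u x * partial_deriv j \<phi> x)
       = - (LINT x:open_square|lebesgue. \<phi> x * v x))"

text \<open>Fubini reduces the identity to lines in direction \<open>j\<close>, where
  one-dimensional integration by parts applies. Smoothness is therefore asked only along these
  lines, which suits maps that are smooth in \<open>y\<close> but not in \<open>x\<close>.\<close>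

lemma weak_partial_derivI:
  assumes meas: "u \<in> borel_measurable borel" "v \<in> borel_measurable borel"
    and bound: "\<And>x. x \<in> open_square \<Longrightarrow> \<bar>u x\<bar> \<le> C" "\<And>x. x \<in> open_square \<Longrightarrow> \<bar>v x\<bar> \<le> C"
    and deriv: "\<And>a b. a \<in> {-1..1} \<Longrightarrow> b \<in> {-1<..<1} \<Longrightarrow>
      ((\<lambda>a. u (line j a b)) has_real_derivative v (line j a b)) (at a within {-1..1})"
    and cont: "\<And>b. b \<in> {-1<..<1} \<Longrightarrow> continuous_on {-1..1} (\<lambda>a. v (line j a b))"
  shows "weak_partial_deriv j u v"
  unfolding weak_partial_deriv_def
proof
  fix \<phi> :: "real^2 \<Rightarrow> real"
  assume \<phi>: "\<phi> \<in> test_functions open_square"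
  note props = test_function_props[OF \<phi>]
  obtain B where B: "B \<ge> 0" "\<And>x. x \<in> closed_square \<Longrightarrow> \<bar>\<phi> x\<bar> \<le> B"
    using continuous_bounded_on_open_square[OF props(1)] by blast
  obtain B' where B': "B' \<ge> 0" "\<And>x. x \<in> closed_square \<Longrightarrow> \<bar>partial_deriv j \<phi> x\<bar> \<le> B'"
    using continuous_bounded_on_open_square[OF props(2)] by blast
  have m: "\<phi> \<in> borel_measurable borel" "partial_deriv j \<phi> \<in> borel_measurable borel"
    using props by (auto intro: borel_measurable_continuous_onI)
  have bd1: "\<bar>u x * partial_deriv j \<phi> x\<bar> \<le> C * B'" if "x \<in> open_square" for x
    using bound(1)[OF that] B'(2)[of x] that open_subset_closed_square
    by (auto simp: abs_mult intro!: mult_mono)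
  have bd2: "\<bar>\<phi> x * v x\<bar> \<le> B * C" if "x \<in> open_square" for x
    using bound(2)[OF that] B(1) B(2)[of x] that open_subset_closed_square
    by (auto simp: abs_mult intro!: mult_mono)
  have inner: "(LINT a:{-1<..<1}|lborel. u (line j a b) * partial_deriv j \<phi> (line j a b))
      = - (LINT a:{-1<..<1}|lborel. \<phi> (line j a b) * v (line j a b))" if b: "b \<in> {-1<..<1}" for b
  proof (rule integral_by_parts_compact_support)
    show "continuous_on {-1..1} (\<lambda>a. partial_deriv j \<phi> (line j a b))"
      using continuous_on_compose2[OF props(2) continuous_on_line(1)] by auto
    show "\<phi> (line j (- 1) b) = 0" "\<phi> (line j 1 b) = 0"
      by (auto intro!: props(4))
  qed (use b deriv cont props(3) in \<open>auto intro: has_field_derivative_at_within\<close>)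
  have "(LINT x:open_square|lebesgue. u x * partial_deriv j \<phi> x) =
      (LINT b:{-1<..<1}|lborel. LINT a:{-1<..<1}|lborel. u (line j a b) * partial_deriv j \<phi> (line j a b))"
    using meas m by (intro set_integral_open_square[OF _ bd1]) auto
  also have "\<dots> = (LINT b:{-1<..<1}|lborel. - (LINT a:{-1<..<1}|lborel. \<phi> (line j a b) * v (line j a b)))"
    using inner by (intro set_lebesgue_integral_cong) auto
  also have "\<dots> = - (LINT x:open_square|lebesgue. \<phi> x * v x)"
    using meas m by (subst set_integral_open_square[OF _ bd2, of _ j]) (auto simp: set_lebesgue_integral_def)
  finally show "(LINT x:open_square|lebesgue. u x * partial_deriv j \<phi> x) =
      - (LINT x:open_square|lebesgue. \<phi> x * v x)" .
qed

section \<open>A continuous singular function\<close>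

definition rat_enum :: "nat \<Rightarrow> real" where
  "rat_enum = from_nat_into \<rat>"

lemma bij_rat_enum: "bij_betw rat_enum UNIV \<rat>"
  unfolding rat_enum_def
  by (intro bij_betw_from_nat_into countable_rat)
    (metis Rats_infinite)

text \<open>The weights sum to 1, the length of the interval \<open>{-1/2..1/2}\<close> that
  contains all values. The strict inequality makes the function left-continuous: its value at a
  rational is the lower end of the gap there.\<close>

definition jump :: "real \<Rightarrow> real" where
  "jump s = - 1 / 2 + (\<Sum>n. if rat_enum n < s then (1 / 2) ^ Suc n else 0)"

lemma summable_jump: "summable (\<lambda>n. if rat_enum n < s then (1 / 2) ^ Suc n else (0::real))"
  by (rule summable_comparison_test'[OF sums_summable[OF power_half_series], of 0]) auto

text \<open>Every term counted at \<open>s\<close> is counted at \<open>s'\<close>, and the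
  \<open>n\<close>-th is counted at \<open>s'\<close> only. Strict monotonicity and the gaps in the
  range both come from this inequality.\<close>

lemma jump_gap:
  assumes "s \<le> rat_enum n" "rat_enum n < s'"
  shows "jump s + (1 / 2) ^ Suc n \<le> jump s'"
proof -
  let ?f = "\<lambda>s n. if rat_enum n < s then (1 / 2) ^ Suc n else (0::real)"
  have "(\<lambda>k. if k = n then (1 / 2) ^ Suc k else (0::real)) sums (1 / 2) ^ Suc n"
    by (rule sums_single)
  then have sums: "(\<lambda>k. ?f s k + (if k = n then (1 / 2) ^ Suc k else 0)) sums ((\<Sum>k. ?f s k) + (1 / 2) ^ Suc n)"
    by (intro sums_add summable_sums summable_jump)
  have "(\<Sum>k. ?f s k) + (1 / 2) ^ Suc n \<le> (\<Sum>k. ?f s' k)"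
  proof (rule sums_le[OF _ sums summable_sums[OF summable_jump]])
    show "?f s k + (if k = n then (1 / 2) ^ Suc k else 0) \<le> ?f s' k" for k
      using assms by auto
  qed
  then show ?thesis by (simp add: jump_def)
qed

lemma jump_strict_mono: "strict_mono jump"
proof
  fix s s' :: real
  assume "s < s'"
  then obtain r where "r \<in> \<rat>" "s < r" "r < s'"
    using Rats_dense_in_real by blast
  moreover then obtain n where "r = rat_enum n"
    using bij_rat_enum by (auto simp: bij_betw_def)
  ultimately show "jump s < jump s'"
    using jump_gap[of s n s'] zero_less_power[of "1 / 2 :: real" "Suc n"] by linarith
qed

lemma jump_bounds: "jump s \<in> {-1/2..1/2}"
proof -
  let ?f = "\<lambda>n. if rat_enum n < s then (1 / 2) ^ Suc n else (0::real)"
  have "0 \<le> (\<Sum>n. ?f n)"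
    by (intro suminf_nonneg summable_jump) auto
  moreover have "(\<Sum>n. ?f n) \<le> 1"
    by (rule sums_le[OF _ summable_sums[OF summable_jump] power_half_series]) auto
  ultimately show ?thesis by (simp add: jump_def)
qed

lemma jump_measurable [measurable]: "jump \<in> borel_measurable borel"
  by (intro borel_measurable_mono strict_mono_mono jump_strict_mono)

text \<open>The gaps left by the jumps have total length \<open>1\<close>, so they exhaust \<open>[-1/2, 1/2]\<close> up to a
  null set.\<close>

lemma jump_range_null:
  obtains Z where "Z \<in> null_sets lborel" "\<And>s. jump s \<in> Z"
proof -
  \<comment> \<open>By \<open>jump_gap\<close>, arguments up to \<open>rat_enum n\<close> have
    values at or below the left end, larger arguments have values at or above the right end.\<close>
  let ?G = "\<lambda>n. {jump (rat_enum n)<..<jump (rat_enum n) + (1 / 2) ^ Suc n}"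
  have sub: "?G n \<subseteq> {-1/2..1/2}" for n
    using jump_gap[of "rat_enum n" n "rat_enum n + 1"] jump_bounds[of "rat_enum n"]
      jump_bounds[of "rat_enum n + 1"] by auto
  have less: "?G m \<inter> ?G n = {}" if "rat_enum m < rat_enum n" for m n
    using jump_gap[OF order_refl that] by auto
  have "disjoint_family ?G"
    unfolding disjoint_family_on_def
  proof (intro ballI impI)
    fix m n :: nat
    assume "m \<noteq> n"
    then have "rat_enum m \<noteq> rat_enum n"
      using bij_rat_enum by (auto simp: bij_betw_def inj_on_def)
    then show "?G m \<inter> ?G n = {}"
      using less[of m n] less[of n m] by (auto simp: Int_commute neq_iff)
  qed
  then have "emeasure lborel (\<Union>n. ?G n) = (\<Sum>n. emeasure lborel (?G n))"
    by (intro suminf_emeasure[symmetric]) auto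
  also have "\<dots> = (\<Sum>n. ennreal ((1 / 2) ^ Suc n))"
    by simp
  also have "\<dots> = ennreal (\<Sum>n. (1 / 2) ^ Suc n)"
    by (intro suminf_ennreal2 sums_summable[OF power_half_series]) auto
  also have "(\<Sum>n. (1 / 2 :: real) ^ Suc n) = 1"
    using power_half_series by (rule sums_unique[symmetric])
  finally have G: "emeasure lborel (\<Union>n. ?G n) = 1"
    by simp
  let ?Z = "{-1/2..1/2} - (\<Union>n. ?G n)"
  have "emeasure lborel ?Z = emeasure lborel {-1/2..1/2::real} - emeasure lborel (\<Union>n. ?G n)"
  proof (rule emeasure_Diff)
    show "emeasure lborel (\<Union>n. ?G n) \<noteq> \<infinity>"
      unfolding G by simp
  qed (simp, simp, use sub in blast)
  also have "\<dots> = 0"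
    unfolding G by simp
  finally have "?Z \<in> null_sets lborel"
    by (intro null_setsI) auto
  moreover have "jump s \<in> ?Z" for s
  proof -
    have "jump s \<notin> ?G n" for n
    proof (cases "s \<le> rat_enum n")
      case True
      then have "jump s \<le> jump (rat_enum n)"
        using jump_strict_mono by (simp add: strict_mono_less_eq)
      then show ?thesis by simp
    next
      case False
      then show ?thesis using jump_gap[of "rat_enum n" n s] by simp
    qed
    then show ?thesis using jump_bounds by simp
  qed
  ultimately show ?thesis by (rule that)
qed

text \<open>The generalised inverse of \<open>jump\<close>, continuous because \<open>jump\<close> is strictly increasing.\<close>

definition stair :: "real \<Rightarrow> real" where
  "stair x = Sup (insert (-1/2) {s \<in> {-1/2..1/2}. jump s \<le> x})"

text \<open>The inserted point -1/2 keeps the supremum meaningful when \<open>x\<close> lies below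
  \<open>jump (-1/2)\<close>; there \<open>stair\<close> is constantly -1/2.\<close>

lemma stair_set:
  "insert (-1/2) {s \<in> {-1/2..1/2}. jump s \<le> x} \<noteq> {}"
  "bdd_above (insert (-1/2) {s \<in> {-1/2..1/2}. jump s \<le> x})"
  by (auto intro!: bdd_aboveI[of _ "1/2"])

text \<open>Together with \<open>less_stair_imp\<close> this is a Galois connection between
  \<open>jump\<close> and \<open>stair\<close>, undecided only at the single point
  \<open>s = stair x\<close>.\<close>

lemma jump_le_imp: "s \<in> {-1/2..1/2} \<Longrightarrow> jump s \<le> x \<Longrightarrow> s \<le> stair x"
  unfolding stair_def using stair_set(2) by (intro cSup_upper) auto

lemma less_stair_imp:
  assumes "s \<in> {-1/2..1/2}" "s < stair x"
  shows "jump s \<le> x"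
proof -
  from assms(2) obtain s' where s': "s < s'" "s' \<in> insert (-1/2) {s \<in> {-1/2..1/2}. jump s \<le> x}"
    unfolding stair_def less_cSup_iff[OF stair_set] by blast
  \<comment> \<open>\<open>s'\<close> exceeds \<open>s\<close>, which is at least -1/2, so it is not
    the inserted point and satisfies \<open>jump s' \<le> x\<close>.\<close>
  then have "jump s < jump s'" "jump s' \<le> x"
    using assms(1) strict_monoD[OF jump_strict_mono] by auto
  then show ?thesis by simp
qed

lemma stair_bounds: "\<bar>stair x\<bar> \<le> 1 / 2"
proof -
  have "stair x \<le> 1 / 2"
    unfolding stair_def by (rule cSup_least[OF stair_set(1)]) auto
  moreover have "-1/2 \<le> stair x"
    unfolding stair_def by (rule cSup_upper[OF _ stair_set(2)]) auto
  ultimately show ?thesis by auto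
qed

lemma continuous_stair: "continuous_on UNIV stair"
proof -
  have upper: "\<exists>d>0. \<forall>y. \<bar>y - x\<bar> < d \<longrightarrow> stair y < stair x + e" if "e > 0" for x e
  proof (cases "stair x + e > 1 / 2")
    case True
    have "stair y < stair x + e" for y
      using True stair_bounds[of y] by auto
    then show ?thesis by (intro exI[of _ 1]) auto
  next
    case False
    \<comment> \<open>\<open>?s\<close> exceeds \<open>stair x\<close>, hence \<open>jump ?s\<close>
      exceeds \<open>x\<close>; every \<open>y\<close> below \<open>jump ?s\<close> has
      \<open>stair y \<le> ?s\<close>.\<close>
    let ?s = "stair x + e / 2"
    have s: "?s \<in> {-1/2..1/2}" using False that stair_bounds[of x] by auto
    have "x < jump ?s" using jump_le_imp[OF s, of x] that by force
    have "stair y \<le> ?s" if "y < jump ?s" for y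
      using less_stair_imp[OF s, of y] that by force
    have "?s < stair x + e" using that by simp
    have "stair y < stair x + e" if "\<bar>y - x\<bar> < jump ?s - x" for y
    proof -
      have "y < jump ?s" using that by linarith
      then show ?thesis
        using \<open>\<And>y. y < jump ?s \<Longrightarrow> stair y \<le> ?s\<close> \<open>?s < stair x + e\<close> by (blast intro: le_less_trans)
    qed
    with \<open>x < jump ?s\<close> show ?thesis
      by (intro exI[of _ "jump ?s - x"]) auto
  qed
  have lower: "\<exists>d>0. \<forall>y. \<bar>y - x\<bar> < d \<longrightarrow> stair x - e < stair y" if "e > 0" for x e
  proof (cases "stair x - e < - 1 / 2")
    case True
    have "stair x - e < stair y" for y
      using True stair_bounds[of y] by auto
    then show ?thesis by (intro exI[of _ 1]) auto
  next
    case False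
    \<comment> \<open>Two points are taken because \<open>less_stair_imp\<close> gives only
      \<open>jump ?s' \<le> x\<close>; strict monotonicity of \<open>jump\<close> then leaves room
      between \<open>jump ?s\<close> and \<open>x\<close>.\<close>
    let ?s = "stair x - e / 2" and ?s' = "stair x - e / 4"
    have s: "?s \<in> {-1/2..1/2}" "?s' \<in> {-1/2..1/2}" using False that stair_bounds[of x] by auto
    have "jump ?s < jump ?s'" using that by (intro strict_monoD[OF jump_strict_mono]) auto
    also have "\<dots> \<le> x" using that by (intro less_stair_imp[OF s(2)]) auto
    finally have less: "jump ?s < x" .
    have "stair x - e < stair y" if "\<bar>y - x\<bar> < x - jump ?s" for y
      using jump_le_imp[OF s(1), of y] that \<open>e > 0\<close> by linarith
    with less show ?thesis by (intro exI[of _ "x - jump ?s"]) auto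
  qed
  have "\<exists>d>0. \<forall>y. dist y x < d \<longrightarrow> dist (stair y) (stair x) < e" if e: "e > 0" for x e
  proof -
    obtain d where d: "d > 0" "\<And>y. \<bar>y - x\<bar> < d \<Longrightarrow> stair y < stair x + e"
      using upper[OF e, of x] by blast
    obtain d' where d': "d' > 0" "\<And>y. \<bar>y - x\<bar> < d' \<Longrightarrow> stair x - e < stair y"
      using lower[OF e, of x] by blast
    have "dist (stair y) (stair x) < e" if "dist y x < min d d'" for y
      using d(2)[of y] d'(2)[of y] that by (auto simp: dist_real_def)
    with d(1) d'(1) show ?thesis
      by (intro exI[of _ "min d d'"]) auto
  qed
  then show ?thesis
    by (simp add: continuous_on_iff)
qed

section \<open>Fibrewise transformations and integration by parts\<close>

text \<open>The addition formula of tanh: for \<open>y = tanh u\<close> and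
  \<open>s = tanh t\<close> the value is \<open>tanh (u + t)\<close>. Hence the endpoints -1 and 1
  stay fixed and \<open>- s\<close> undoes \<open>s\<close>.\<close>

definition mob :: "real \<Rightarrow> real \<Rightarrow> real" where
  "mob s y = (y + s) / (1 + s * y)"

definition mob_ds :: "real \<Rightarrow> real \<Rightarrow> real" where
  "mob_ds s y = (1 - y\<^sup>2) / (1 + s * y)\<^sup>2"

definition mob_dy :: "real \<Rightarrow> real \<Rightarrow> real" where
  "mob_dy s y = (1 - s\<^sup>2) / (1 + s * y)\<^sup>2"

text \<open>The bound 1/2 on the parameter is the one that \<open>stair\<close> obeys. Keeping the
  denominator at least 1/2 yields the constant 4 in the later bounds on the derivatives.\<close>

lemma mob_denom:
  fixes s y :: real
  assumes "\<bar>s\<bar> \<le> 1 / 2" "\<bar>y\<bar> \<le> 1"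
  shows "1 / 2 \<le> 1 + s * y"
proof -
  have "\<bar>s * y\<bar> \<le> 1 / 2 * 1"
    unfolding abs_mult using assms by (intro mult_mono) auto
  then show ?thesis by linarith
qed

lemma mob_bounds:
  assumes "\<bar>s\<bar> \<le> 1 / 2" "\<bar>y\<bar> \<le> 1"
  shows "\<bar>mob s y\<bar> \<le> 1"
proof -
  \<comment> \<open>Expanded, the two products bound \<open>y + s\<close> from above and from below
    by the denominator up to sign.\<close>
  have "0 \<le> (1 - s) * (1 - y)" "0 \<le> (1 + s) * (1 + y)"
    using assms by auto
  then have "\<bar>y + s\<bar> \<le> 1 + s * y"
    by (auto simp: algebra_simps)
  then show ?thesis
    using mob_denom[OF assms] by (simp add: mob_def)
qed

lemma mob_inverse:
  assumes "\<bar>s\<bar> \<le> 1 / 2" "\<bar>y\<bar> \<le> 1"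
  shows "mob (- s) (mob s y) = y"
proof -
  have d: "1 + s * y \<noteq> 0" using mob_denom[OF assms] by simp
  have "1 - s * mob s y = (1 - s\<^sup>2) / (1 + s * y)"
    using d by (simp add: mob_def field_simps power2_eq_square)
  moreover have "mob s y - s = y * (1 - s\<^sup>2) / (1 + s * y)"
    using d by (simp add: mob_def field_simps power2_eq_square)
  moreover have "s\<^sup>2 < 1"
    using assms(1) by (intro abs_square_less_1[THEN iffD2]) auto
  ultimately show ?thesis
    using d by (simp add: mob_def)
qed

lemma mob_has_derivative_s:
  assumes "\<bar>s\<bar> \<le> 1 / 2" "\<bar>y\<bar> \<le> 1"
  shows "((\<lambda>s. mob s y) has_real_derivative mob_ds s y) (at s)"
  using mob_denom[OF assms] unfolding mob_def mob_ds_def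
  by (auto intro!: derivative_eq_intros simp: power2_eq_square algebra_simps)

lemma mob_has_derivative_y:
  assumes "\<bar>s\<bar> \<le> 1 / 2" "\<bar>y\<bar> \<le> 1"
  shows "(mob s has_real_derivative mob_dy s y) (at y)"
  using mob_denom[OF assms] unfolding mob_def[abs_def] mob_dy_def
  by (auto intro!: derivative_eq_intros simp: power2_eq_square algebra_simps)

lemma mob_dy_pos: "\<bar>s\<bar> \<le> 1 / 2 \<Longrightarrow> \<bar>y\<bar> \<le> 1 \<Longrightarrow> 0 < mob_dy s y"
  using mob_denom[of s y] abs_square_less_1[of s] by (auto simp: mob_dy_def)

lemma mob_ds_pos: "\<bar>s\<bar> \<le> 1 / 2 \<Longrightarrow> \<bar>y\<bar> < 1 \<Longrightarrow> 0 < mob_ds s y"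
  using mob_denom[of s y] abs_square_less_1[of y] by (auto simp: mob_ds_def)

lemma mob_quotient_le:
  fixes s y :: real
  assumes "\<bar>s\<bar> \<le> 1 / 2" "\<bar>y\<bar> \<le> 1" "0 \<le> z" "z \<le> 1"
  shows "z / (1 + s * y)\<^sup>2 \<le> 4"
proof -
  have "(1 / 2)\<^sup>2 \<le> (1 + s * y)\<^sup>2"
    using mob_denom[OF assms(1,2)] by (intro power_mono) auto
  then have "1 \<le> 4 * (1 + s * y)\<^sup>2" "0 < (1 + s * y)\<^sup>2"
    by (auto simp: power2_eq_square)
  then show ?thesis
    using assms(4) by (simp add: field_simps)
qed

lemma mob_dy_le: "\<bar>s\<bar> \<le> 1 / 2 \<Longrightarrow> \<bar>y\<bar> \<le> 1 \<Longrightarrow> mob_dy s y \<le> 4"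
  using abs_square_le_1[of s] unfolding mob_dy_def by (intro mob_quotient_le) auto

lemma mob_ds_le: "\<bar>s\<bar> \<le> 1 / 2 \<Longrightarrow> \<bar>y\<bar> \<le> 1 \<Longrightarrow> mob_ds s y \<le> 4"
  using abs_square_le_1[of y] unfolding mob_ds_def by (intro mob_quotient_le) auto

section \<open>Integration by parts against \<open>stair\<close>\<close>

lemma set_integral_deriv_Icc:
  fixes F f :: "real \<Rightarrow> real"
  assumes "a \<le> b" "continuous_on {a..b} f"
    "\<And>x. x \<in> {a..b} \<Longrightarrow> (F has_real_derivative f x) (at x within {a..b})"
  shows "(LINT x:{a..b}|lborel. f x) = F b - F a"
proof -
  have "(LBINT x=ereal a..ereal b. f x) = F b - F a"
    using assms
    by (intro interval_integral_FTC_finite)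
      (auto simp flip: has_real_derivative_iff_has_vector_derivative)
  then show ?thesis
    using interval_integral_Icc[OF assms(1), of f] by simp
qed

text \<open>The two sets can differ only at \<open>s = stair x\<close>, the point that the Galois
  connection leaves undecided.\<close>

lemma AE_indicator_jump:
  "AE s in lborel. indicator {-1/2..1/2} s * indicator {s. jump s \<le> x} s
     = (indicator {-1/2..stair x} s :: real)"
  using AE_lborel_singleton[of "stair x"]
proof eventually_elim
  case (elim s)
  show ?case
  proof (cases "s \<in> {-1/2..1/2}")
    case True
    then have "jump s \<le> x \<longleftrightarrow> s \<le> stair x"
      using elim jump_le_imp[OF True] less_stair_imp[OF True, of x] by force
    with True show ?thesis by (auto simp: indicator_def)
  next
    case False
    then show ?thesis using stair_bounds[of x] by (auto simp: indicator_def)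
  qed
qed

text \<open>Integration by parts for \<open>G \<circ> stair\<close>: writing \<open>G \<circ> stair\<close> as an integral over
  \<open>{s. jump s \<le> x}\<close> and exchanging the integrals shows that the derivative of \<open>G \<circ> stair\<close> is the
  image of \<open>g ds\<close> under \<open>jump\<close>.\<close>

lemma stair_by_parts:
  fixes G g p p' :: "real \<Rightarrow> real"
  assumes G: "\<And>s. s \<in> {-1/2..1/2} \<Longrightarrow> (G has_real_derivative g s) (at s within {-1/2..1/2})"
    and p: "\<And>x. x \<in> {-1..1} \<Longrightarrow> (p has_real_derivative p' x) (at x within {-1..1})"
    and cont: "continuous_on {-1/2..1/2} g" "continuous_on {-1..1} p'"
    and bd: "p (-1) = 0" "p 1 = 0"
  shows "(LINT x:{-1<..<1}|lborel. G (stair x) * p' x) =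
    - (LINT s:{-1/2..1/2}|lborel. g s * p (jump s))"
proof -
  let ?X = "{-1..1::real}" and ?J = "{-1/2..1/2::real}"
  define q where "q x = indicator ?X x * p' x" for x
  define h where "h s = indicator ?J s * g s" for s
  have meas [measurable]: "q \<in> borel_measurable borel" "h \<in> borel_measurable borel"
    using borel_measurable_continuous_on_indicator[OF _ cont(2)]
      borel_measurable_continuous_on_indicator[OF _ cont(1)]
    by (auto simp: q_def[abs_def] h_def[abs_def])
  have "bounded (p' ` ?X)"
    by (intro compact_imp_bounded compact_continuous_image[OF cont(2)]) simp
  then obtain B where B: "\<And>x. x \<in> ?X \<Longrightarrow> \<bar>p' x\<bar> \<le> B"
    unfolding bounded_iff by fastforce
  have "bounded (g ` ?J)"
    by (intro compact_imp_bounded compact_continuous_image[OF cont(1)]) simp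
  then obtain C where C: "\<And>s. s \<in> ?J \<Longrightarrow> \<bar>g s\<bar> \<le> C"
    unfolding bounded_iff by fastforce
  have B0: "0 \<le> B" using B[of 0] by simp
  define H where "H x s = q x * (indicator {s. jump s \<le> x} s * h s)" for x s
  have H_int: "integrable (lborel \<Otimes>\<^sub>M lborel) (case_prod H)"
  proof (rule integrableI_bounded_set[of "?X \<times> ?J" _ _ "B * C"])
    have "(\<lambda>(x, s). q x * ((if jump s \<le> x then 1 else 0) * h s)) \<in> borel_measurable (lborel \<Otimes>\<^sub>M lborel)"
      by measurable
    then show "case_prod H \<in> borel_measurable (lborel \<Otimes>\<^sub>M lborel)"
      by (simp add: H_def[abs_def] indicator_def of_bool_def)
    show "emeasure (lborel \<Otimes>\<^sub>M lborel) (?X \<times> ?J) < \<infinity>"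
      by (simp add: lborel.emeasure_pair_measure_Times ennreal_mult_less_top)
    have "\<bar>H x s\<bar> \<le> B * C" if "x \<in> ?X" "s \<in> ?J" for x s
    proof -
      have "\<bar>q x\<bar> \<le> B" "\<bar>h s\<bar> \<le> C" using B C that by (auto simp: q_def h_def)
      then have "\<bar>q x\<bar> * \<bar>indicator {s. jump s \<le> x} s * h s\<bar> \<le> B * C"
        using B0 by (intro mult_mono) (auto simp: indicator_def)
      then show ?thesis by (simp add: H_def abs_mult)
    qed
    then show "AE z in lborel \<Otimes>\<^sub>M lborel. z \<in> ?X \<times> ?J \<longrightarrow> norm (case_prod H z) \<le> B * C"
      by auto
    have "case_prod H z = 0" if "z \<notin> ?X \<times> ?J" for z
      using that by (cases z) (auto simp: H_def q_def h_def indicator_def)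
    then show "AE z in lborel \<Otimes>\<^sub>M lborel. z \<notin> ?X \<times> ?J \<longrightarrow> case_prod H z = 0"
      by (intro AE_I2 impI)
  qed simp
  \<comment> \<open>Integrating over \<open>s\<close> first: the condition
    \<open>jump s \<le> x\<close> becomes \<open>s \<le> stair x\<close>, and the fundamental
    theorem applies to \<open>g\<close>.\<close>
  have int_s: "(LINT s|lborel. H x s) = q x * (G (stair x) - G (-1/2))" for x
  proof -
    have "(LINT s|lborel. indicator {s. jump s \<le> x} s * h s) = (LINT s|lborel. indicator {-1/2..stair x} s * g s)"
    proof (rule integral_cong_AE)
      have "continuous_on {-1/2..stair x} g"
        using cont(1) by (rule continuous_on_subset) (use stair_bounds[of x] in auto)
      then show "(\<lambda>s. indicator {-1/2..stair x} s * g s) \<in> borel_measurable lborel"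
        using borel_measurable_continuous_on_indicator[of "{-1/2..stair x}" g] by simp
      have "{s. jump s \<le> x} \<in> sets borel" by measurable
      then show "(\<lambda>s. indicator {s. jump s \<le> x} s * h s) \<in> borel_measurable lborel"
        by measurable
      show "AE s in lborel. indicator {s. jump s \<le> x} s * h s = indicator {-1/2..stair x} s * g s"
        using AE_indicator_jump[of x]
      proof eventually_elim
        case (elim s)
        have "indicator {s. jump s \<le> x} s * h s =
            (indicator {-1/2..1/2} s * indicator {s. jump s \<le> x} s) * g s"
          by (simp add: h_def)
        then show ?case by (simp only: elim)
      qed
    qed
    also have "\<dots> = (LINT s:{-1/2..stair x}|lborel. g s)"
      by (simp add: set_lebesgue_integral_def)
    also have "\<dots> = G (stair x) - G (-1/2)"
    proof (rule set_integral_deriv_Icc)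
      show "-1/2 \<le> stair x" using stair_bounds[of x] by auto
      have sub: "{-1/2..stair x} \<subseteq> ?J" using stair_bounds[of x] by auto
      show "continuous_on {-1/2..stair x} g" using cont(1) sub by (rule continuous_on_subset)
      show "(G has_real_derivative g s) (at s within {-1/2..stair x})" if "s \<in> {-1/2..stair x}" for s
        using G[of s] sub that by (meson has_field_derivative_subset subsetD)
    qed
    finally show ?thesis by (simp add: H_def)
  qed
  \<comment> \<open>Integrating over \<open>x\<close> first: \<open>p'\<close> is integrated from
    \<open>jump s\<close> to 1, where \<open>p\<close> vanishes.\<close>
  have int_x: "(LINT x|lborel. H x s) = - h s * p (jump s)" for s
  proof -
    have j: "-1 \<le> jump s" "jump s \<le> 1" using jump_bounds[of s] by auto
    then have sub: "{jump s..1} \<subseteq> ?X" by auto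
    have "(LINT x|lborel. H x s) = h s * (LINT x|lborel. indicator {jump s..1} x * p' x)"
      unfolding integral_mult_right_zero[symmetric]
      using j by (intro Bochner_Integration.integral_cong) (auto simp: H_def q_def indicator_def)
    also have "(LINT x|lborel. indicator {jump s..1} x * p' x) = (LINT x:{jump s..1}|lborel. p' x)"
      by (simp add: set_lebesgue_integral_def)
    also have "\<dots> = p 1 - p (jump s)"
    proof (rule set_integral_deriv_Icc[OF j(2)])
      show "continuous_on {jump s..1} p'" using cont(2) sub by (rule continuous_on_subset)
      show "(p has_real_derivative p' x) (at x within {jump s..1})" if "x \<in> {jump s..1}" for x
        using p[of x] sub that by (meson has_field_derivative_subset subsetD)
    qed
    finally show ?thesis using bd by simp
  qed
  have "(LINT x|lborel. q x * (G (stair x) - G (-1/2))) = (LINT s|lborel. - h s * p (jump s))"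
    using lborel_pair.Fubini_integral[OF H_int] by (simp add: int_s int_x)
  \<comment> \<open>The constant \<open>G (-1/2)\<close> from the inner integral drops out because
    \<open>p\<close> vanishes at both ends.\<close>
  moreover have q0: "(LINT x|lborel. q x) = 0"
    using set_integral_deriv_Icc[OF _ cont(2) p] bd by (simp add: q_def[abs_def] set_lebesgue_integral_def)
  moreover have "integrable lborel q"
    using borel_integrable_atLeastAtMost'[OF cont(2)] by (simp add: q_def[abs_def] set_integrable_def)
  moreover have "integrable lborel (\<lambda>x. q x * (G (stair x) - G (-1/2)))"
    using lborel_pair.integrable_fst'[OF H_int] by (simp add: int_s)
  ultimately have "(LINT x|lborel. q x * (G (stair x) - G (-1/2)) + q x * G (-1/2)) =
      (LINT s|lborel. - h s * p (jump s))"
    by simp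
  then have "(LINT x:?X|lborel. G (stair x) * p' x) = (LINT s|lborel. - h s * p (jump s))"
    by (simp add: q_def set_lebesgue_integral_def algebra_simps)
  moreover have "(LINT s|lborel. - h s * p (jump s)) = - (LINT s:?J|lborel. g s * p (jump s))"
    by (simp add: h_def set_lebesgue_integral_def mult.assoc)
  ultimately show ?thesis
    by (simp add: set_integral_Ioo_eq_Icc)
qed

section \<open>The singular part of the gradient\<close>

text \<open>The derivative of \<open>mob (c * s) y\<close> in \<open>s\<close> is
  \<open>c * mob_ds (c * s) y\<close>. The sign \<open>c\<close> is split off so that the density is
  nonnegative and defines a positive measure.\<close>

definition jump_density :: "real \<Rightarrow> real \<times> real \<Rightarrow> real" where
  "jump_density c = (\<lambda>(s, y). indicator {-1/2..1/2} s * indicator {-1<..<1} y * mob_ds (c * s) y)"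

definition stair_measure :: "real \<Rightarrow> (real^2) measure" where
  "stair_measure c = distr (density (lborel \<Otimes>\<^sub>M lborel) (\<lambda>p. ennreal (jump_density c p))) borel
     (\<lambda>(s, y). line 1 (jump s) y)"

lemma jump_density_measurable [measurable]:
  "jump_density c \<in> borel_measurable (lborel \<Otimes>\<^sub>M lborel)"
  unfolding jump_density_def mob_ds_def by measurable

lemma line_jump_measurable [measurable]:
  "(\<lambda>(s, y). line 1 (jump s) y) \<in> borel_measurable (lborel \<Otimes>\<^sub>M lborel)"
proof -
  have "(\<lambda>(s, y). (jump s, y)) \<in> measurable (lborel \<Otimes>\<^sub>M lborel) (lborel \<Otimes>\<^sub>M lborel)"
    by measurable
  from measurable_compose[OF this line_measurable[of 1]] show ?thesis
    by (simp add: case_prod_beta')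
qed

lemma jump_density_nonneg:
  "0 \<le> jump_density c p"
proof -
  have "0 \<le> mob_ds s y" if "y \<in> {-1<..<1}" for s y
    using that abs_square_le_1[of y] by (auto simp: mob_ds_def)
  then show ?thesis
    by (auto simp: jump_density_def indicator_def split: prod.split)
qed

lemma jump_density_le:
  assumes "\<bar>c\<bar> = 1"
  shows "jump_density c p \<le> 4"
proof -
  obtain s y where p: "p = (s, y)" by force
  have "mob_ds (c * s) y \<le> 4" if "s \<in> {-1/2..1/2}" "y \<in> {-1<..<1}"
    using that assms by (intro mob_ds_le) (auto simp: abs_mult)
  then show ?thesis
    by (auto simp: p jump_density_def indicator_def)
qed

lemma jump_density_eq_0: "p \<notin> {-1/2..1/2} \<times> {-1<..<1} \<Longrightarrow> jump_density c p = 0"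
  by (cases p) (auto simp: jump_density_def)

lemma jump_density_integrable:
  assumes c: "\<bar>c\<bar> = 1" and f: "f \<in> borel_measurable (lborel \<Otimes>\<^sub>M lborel)" "\<And>p. \<bar>f p\<bar> \<le> B"
  shows "integrable (lborel \<Otimes>\<^sub>M lborel) (\<lambda>p. jump_density c p * f p)"
proof (rule integrableI_bounded_set[of "{-1/2..1/2} \<times> {-1<..<1}" _ _ "4 * B"])
  show "emeasure (lborel \<Otimes>\<^sub>M lborel) ({-1/2..1/2::real} \<times> {-1<..<1::real}) < \<infinity>"
    by (simp add: lborel.emeasure_pair_measure_Times ennreal_mult_less_top)
  have "\<bar>jump_density c p * f p\<bar> \<le> 4 * B" for p
    unfolding abs_mult using jump_density_nonneg[of c p] jump_density_le[OF c, of p] f(2)[of p]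
    by (intro mult_mono) auto
  then show "AE p in lborel \<Otimes>\<^sub>M lborel. p \<in> {-1/2..1/2} \<times> {-1<..<1} \<longrightarrow>
      norm (jump_density c p * f p) \<le> 4 * B"
    by (intro AE_I2) simp
  show "AE p in lborel \<Otimes>\<^sub>M lborel. p \<notin> {-1/2..1/2} \<times> {-1<..<1} \<longrightarrow> jump_density c p * f p = 0"
    using jump_density_eq_0 by (intro AE_I2) simp
qed (use f in measurable)

lemma sets_stair_measure [simp]: "sets (stair_measure c) = sets borel"
  by (simp add: stair_measure_def)

lemma space_stair_measure [simp]: "space (stair_measure c) = UNIV"
  by (simp add: stair_measure_def)

lemma finite_measure_stair_measure:
  assumes "\<bar>c\<bar> = 1"
  shows "finite_measure (stair_measure c)"
  unfolding stair_measure_def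
proof (rule finite_measure.finite_measure_distr)
  have "integrable (lborel \<Otimes>\<^sub>M lborel) (jump_density c)"
    using jump_density_integrable[OF assms, of "\<lambda>_. 1" 1] by simp
  then have "(\<integral>\<^sup>+p. ennreal (jump_density c p) \<partial>(lborel \<Otimes>\<^sub>M lborel)) < \<infinity>"
    using jump_density_nonneg by (simp add: integrable_iff_bounded)
  moreover have "emeasure (density (lborel \<Otimes>\<^sub>M lborel) (\<lambda>p. ennreal (jump_density c p)))
      (space (lborel \<Otimes>\<^sub>M lborel)) = (\<integral>\<^sup>+p. ennreal (jump_density c p) \<partial>(lborel \<Otimes>\<^sub>M lborel))"
    by (subst emeasure_density[OF _ sets.top]) (auto intro!: nn_integral_cong)
  ultimately show "finite_measure (density (lborel \<Otimes>\<^sub>M lborel) (\<lambda>p. ennreal (jump_density c p)))"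
    by (intro finite_measureI) simp
qed simp

text \<open>The integral over \<open>s\<close> is the inner one: this is the form in which
  \<open>stair_by_parts\<close> delivers the derivative on each horizontal line.\<close>

lemma integral_stair_measure:
  assumes c: "\<bar>c\<bar> = 1" and \<phi>: "\<phi> \<in> borel_measurable borel" "\<And>x. \<bar>\<phi> x\<bar> \<le> B"
  shows "(LINT x|stair_measure c. \<phi> x) =
    (LINT y:{-1<..<1}|lborel. LINT s:{-1/2..1/2}|lborel. mob_ds (c * s) y * \<phi> (line 1 (jump s) y))"
proof -
  let ?l = "\<lambda>(s, y). line 1 (jump s) y"
  have m: "(\<lambda>p. \<phi> (?l p)) \<in> borel_measurable (lborel \<Otimes>\<^sub>M lborel)"
    using measurable_compose[OF line_jump_measurable \<phi>(1)] .
  have "(LINT x|stair_measure c. \<phi> x) =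
      (LINT p|density (lborel \<Otimes>\<^sub>M lborel) (\<lambda>p. ennreal (jump_density c p)). \<phi> (?l p))"
    unfolding stair_measure_def by (intro integral_distr \<phi>) simp
  also have "\<dots> = (LINT p|(lborel \<Otimes>\<^sub>M lborel). jump_density c p * \<phi> (?l p))"
    using m jump_density_nonneg by (subst integral_density) auto
  also have "\<dots> = (LINT y|lborel. LINT s|lborel. jump_density c (s, y) * \<phi> (line 1 (jump s) y))"
    using lborel_pair.integral_snd[of "\<lambda>s y. jump_density c (s, y) * \<phi> (line 1 (jump s) y)"]
      jump_density_integrable[OF c m, of B] \<phi>(2)
    by (simp add: case_prod_beta')
  also have "\<dots> = (LINT y:{-1<..<1}|lborel. LINT s:{-1/2..1/2}|lborel. mob_ds (c * s) y * \<phi> (line 1 (jump s) y))"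
    unfolding set_lebesgue_integral_def
    by (intro Bochner_Integration.integral_cong refl)
      (simp add: jump_density_def mult.assoc mult.left_commute flip: integral_mult_right_zero)
  finally show ?thesis .
qed

lemma emeasure_stair_measure:
  assumes "E \<in> sets borel"
  shows "emeasure (stair_measure c) E =
    (\<integral>\<^sup>+p. ennreal (jump_density c p) * indicator E (case p of (s, y) \<Rightarrow> line 1 (jump s) y) \<partial>(lborel \<Otimes>\<^sub>M lborel))"
proof -
  let ?l = "\<lambda>(s, y). line 1 (jump s) y"
  have meas: "?l -` E \<inter> space (lborel \<Otimes>\<^sub>M lborel) \<in> sets (lborel \<Otimes>\<^sub>M lborel)"
    using assms by (rule measurable_sets[OF line_jump_measurable])
  have "emeasure (stair_measure c) E =
      emeasure (density (lborel \<Otimes>\<^sub>M lborel) (\<lambda>p. ennreal (jump_density c p)))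
        (?l -` E \<inter> space (lborel \<Otimes>\<^sub>M lborel))"
    unfolding stair_measure_def using assms by (subst emeasure_distr) auto
  also have "\<dots> = (\<integral>\<^sup>+p. ennreal (jump_density c p) * indicator (?l -` E \<inter> space (lborel \<Otimes>\<^sub>M lborel)) p \<partial>(lborel \<Otimes>\<^sub>M lborel))"
    using meas by (intro emeasure_density) simp
  also have "\<dots> = (\<integral>\<^sup>+p. ennreal (jump_density c p) * indicator E (?l p) \<partial>(lborel \<Otimes>\<^sub>M lborel))"
    by (intro nn_integral_cong) (auto simp: indicator_def)
  finally show ?thesis .
qed

text \<open>The null set is the vertical cylinder over a null set that contains the range of
  \<open>jump\<close>; it serves both signs \<open>c\<close> at once.\<close>

lemma stair_measure_singular:
  "\<exists>Z\<in>null_sets lborel. \<forall>c. \<forall>E\<in>sets borel. E \<inter> Z = {} \<longrightarrow> emeasure (stair_measure c) E = 0"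
proof -
  obtain Z where Z: "Z \<in> null_sets lborel" "\<And>s. jump s \<in> Z"
    using jump_range_null by blast
  let ?Z = "{x :: real^2. x $ 1 \<in> Z}"
  have "(\<lambda>x::real^2. x $ 1) \<in> borel_measurable borel"
    by (intro borel_measurable_continuous_onI continuous_intros)
  then have borel: "?Z \<in> sets borel"
    using Z(1) measurable_sets[of "\<lambda>x::real^2. x $ 1" borel borel Z] by (auto simp: vimage_def)
  moreover have "?Z \<in> null_sets lborel"
    unfolding null_sets_line[OF borel] using AE_not_in[OF Z(1)] by eventually_elim simp
  moreover have "emeasure (stair_measure c) E = 0" if "E \<in> sets borel" "E \<inter> ?Z = {}" for c E
  proof -
    have "line 1 (jump s) y \<notin> E" for s y
      using that(2) Z(2)[of s] by auto
    then show ?thesis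
      by (simp add: emeasure_stair_measure[OF that(1)] case_prod_beta')
  qed
  ultimately show ?thesis by blast
qed

text \<open>The density is positive on the unit square \<open>?R\<close>, which is mapped into
  \<open>{-1/2..1/2}\<close> in both coordinates. The constant 3/4 lies between 1/2 and 1, so the
  box contains this image while its closure stays inside the open square.\<close>

lemma stair_measure_box_pos:
  assumes c: "\<bar>c\<bar> = 1"
  shows "emeasure (stair_measure c) (box (vec (-3/4)) (vec (3/4))) > 0"
proof (rule ccontr)
  let ?B = "box (vec (-3/4)) (vec (3/4)) :: (real^2) set"
  let ?R = "{-1/2..1/2::real} \<times> {-1/2..1/2::real}"
  assume "\<not> ?thesis"
  then have "(\<integral>\<^sup>+p. ennreal (jump_density c p) * indicator ?B (case p of (s, y) \<Rightarrow> line 1 (jump s) y) \<partial>(lborel \<Otimes>\<^sub>M lborel)) = 0"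
    by (simp add: emeasure_stair_measure)
  moreover have "(\<lambda>p. ennreal (jump_density c p) * indicator ?B (case p of (s, y) \<Rightarrow> line 1 (jump s) y))
      \<in> borel_measurable (lborel \<Otimes>\<^sub>M lborel)"
    by (intro borel_measurable_times_ennreal measurable_compose[OF line_jump_measurable]
        measurable_compose[OF jump_density_measurable] borel_measurable_indicator) auto
  ultimately have ae: "AE p in lborel \<Otimes>\<^sub>M lborel.
      ennreal (jump_density c p) * indicator ?B (case p of (s, y) \<Rightarrow> line 1 (jump s) y) = 0"
    by (simp add: nn_integral_0_iff_AE)
  have not_R: "p \<notin> ?R"
    if "ennreal (jump_density c p) * indicator ?B (case p of (s, y) \<Rightarrow> line 1 (jump s) y) = 0" for p
  proof
    assume p: "p \<in> ?R"
    then obtain s y where sy: "p = (s, y)" "s \<in> {-1/2..1/2}" "y \<in> {-1/2..1/2}" by auto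
    then have "0 < mob_ds (c * s) y"
      using c by (intro mob_ds_pos) (auto simp: abs_mult)
    moreover have "line 1 (jump s) y \<in> ?B"
      using jump_bounds[of s] sy by (auto simp: mem_box_cart forall_2)
    ultimately show False
      using that sy by (auto simp: jump_density_def ennreal_eq_0_iff)
  qed
  have "AE p in lborel \<Otimes>\<^sub>M lborel. p \<notin> ?R"
    using ae by (rule eventually_mono) (rule not_R)
  moreover have R: "?R \<in> sets (lborel \<Otimes>\<^sub>M lborel)" by simp
  ultimately have "emeasure (lborel \<Otimes>\<^sub>M lborel) ?R = 0"
    using AE_iff_null_sets[OF R] null_setsD1 by blast
  then show False
    by (simp add: lborel.emeasure_pair_measure_Times)
qed

text \<open>With \<open>stair_neg\<close> this writes the signed measure
  \<open>c * stair_measure c\<close>, for \<open>c\<close> equal to 1 or -1, as the difference of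
  positive measures that the definitions require.\<close>

definition stair_pos :: "real \<Rightarrow> (real^2) measure" where
  "stair_pos c = (if c = 1 then stair_measure c else null_measure borel)"

definition stair_neg :: "real \<Rightarrow> (real^2) measure" where
  "stair_neg c = (if c = 1 then null_measure borel else stair_measure c)"

lemma integral_null_measure [simp]: "(LINT x|null_measure M. (f x :: real)) = 0"
  by (rule integral_eq_zero_AE) (auto simp: eventually_ae_filter null_sets_def intro!: bexI[of _ "space M"])

lemma measure_null_measure [simp]: "measure (null_measure M) E = 0"
  by (simp add: measure_def)

lemma finite_measure_null_measure: "finite_measure (null_measure M)"
  by (rule finite_measureI) simp

lemma finite_borel_on_restrict:
  "finite_measure M \<Longrightarrow> sets M = sets borel \<Longrightarrow> U \<in> sets borel \<Longrightarrow> finite_borel_on U (restrict_space M U)"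
  unfolding finite_borel_on_def
  by (intro conjI finite_measure_restrict_space sets_restrict_space_cong) auto

lemma finite_borel_on_stair:
  assumes "\<bar>c\<bar> = 1" "U \<in> sets borel"
  shows "finite_borel_on U (restrict_space (stair_pos c) U)"
    "finite_borel_on U (restrict_space (stair_neg c) U)"
  using assms unfolding stair_pos_def stair_neg_def
  by (auto intro!: finite_borel_on_restrict finite_measure_stair_measure finite_measure_null_measure)

lemma stair_pos_neg_integral:
  fixes \<phi> :: "real^2 \<Rightarrow> real"
  assumes c: "\<bar>c\<bar> = 1" and U: "U \<in> sets borel" and \<phi>: "\<And>x. x \<notin> U \<Longrightarrow> \<phi> x = 0"
  shows "(LINT x|restrict_space (stair_pos c) U. \<phi> x) - (LINT x|restrict_space (stair_neg c) U. \<phi> x)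
    = c * (LINT x|stair_measure c. \<phi> x)"
proof -
  have ind: "indicator U x * \<phi> x = \<phi> x" for x
    using \<phi> by (auto simp: indicator_def)
  from c have "c = 1 \<or> c = -1" by auto
  then show ?thesis
    using U by (auto simp: stair_pos_def stair_neg_def integral_restrict_space ind)
qed

lemma stair_pos_neg_measure:
  assumes c: "\<bar>c\<bar> = 1" and U: "U \<in> sets borel" and E: "E \<in> sets borel"
  shows "measure (restrict_space (stair_pos c) U) (U \<inter> E) - measure (restrict_space (stair_neg c) U) (U \<inter> E)
    = c * measure (stair_measure c) (U \<inter> E)"
proof -
  from c have "c = 1 \<or> c = -1" by auto
  then show ?thesis
    using U E by (auto simp: stair_pos_def stair_neg_def measure_restrict_space)
qed

lemma lebesgue_singular_stair:
  assumes c: "\<bar>c\<bar> = 1" and U: "U \<in> sets borel"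
  shows "lebesgue_singular (restrict_space (stair_pos c) U)"
    "lebesgue_singular (restrict_space (stair_neg c) U)"
proof -
  obtain Z where Z: "Z \<in> null_sets lborel"
    and Z0: "\<forall>c. \<forall>E\<in>sets borel. E \<inter> Z = {} \<longrightarrow> emeasure (stair_measure c) E = 0"
    using stair_measure_singular by blast
  have Zb: "Z \<in> sets borel" using Z by auto
  have "U - Z \<in> sets borel" using U Zb by simp
  then have "emeasure (stair_pos c) (U - Z) = 0" "emeasure (stair_neg c) (U - Z) = 0"
    using Z0 by (auto simp: stair_pos_def stair_neg_def)
  moreover have "sets (stair_pos c) = sets borel" "sets (stair_neg c) = sets borel"
    by (auto simp: stair_pos_def stair_neg_def)
  moreover then have "space (stair_pos c) = UNIV" "space (stair_neg c) = UNIV"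
    by (auto dest: sets_eq_imp_space_eq)
  ultimately show "lebesgue_singular (restrict_space (stair_pos c) U)"
    "lebesgue_singular (restrict_space (stair_neg c) U)"
    unfolding lebesgue_singular_def using U Z Zb
    by (auto intro!: bexI[of _ Z] simp: null_sets_restrict_space space_restrict_space null_sets_def sets_restrict_space_iff emeasure_restrict_space)
qed

section \<open>Absolutely continuous parts\<close>

lemma finite_borel_on_null_measure: "U \<in> sets borel \<Longrightarrow> finite_borel_on U (null_measure (restrict_space borel U))"
  by (simp add: finite_borel_on_def finite_measure_null_measure)

lemma lebesgue_singular_null_measure: "lebesgue_singular (null_measure (restrict_space borel U))"
  unfolding lebesgue_singular_def
  by (intro bexI[of _ "{}"]) (auto simp: null_sets_def space_restrict_space sets_restrict_space intro: image_eqI[of _ _ UNIV])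

text \<open>For nonnegative \<open>v\<close> the measure with density \<open>v\<close> paired with
  the zero measure represents the derivative, and the singular part is zero.\<close>

lemma weak_deriv_imp_distr_deriv:
  assumes w: "weak_partial_deriv j u v" and v: "v \<in> borel_measurable borel"
    and nonneg: "\<And>x. x \<in> open_square \<Longrightarrow> 0 \<le> v x" and le: "\<And>x. x \<in> open_square \<Longrightarrow> v x \<le> C"
  shows "\<exists>P N. distr_deriv_measure open_square u j P N \<and> ac_part_density open_square P N v"
proof -
  let ?U = open_square
  let ?R = "restrict_space lborel ?U"
  let ?P = "density ?R (\<lambda>x. ennreal (v x))"
  let ?N = "null_measure (restrict_space borel ?U)"
  have int: "set_integrable lborel ?U v"
    using set_integrable_bounded[OF v, of ?U C] nonneg le bounded_open_square by auto
  have vR: "v \<in> borel_measurable ?R"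
    using v by (auto intro: measurable_restrict_space1)
  have spaceR: "space ?R = ?U" by (simp add: space_restrict_space)
  have AE: "AE x in ?R. 0 \<le> v x"
    using nonneg by (intro AE_I2) (simp add: spaceR)
  have "integrable ?R v"
    using int by (subst integrable_restrict_space) (auto simp: set_integrable_def)
  then have "(\<integral>\<^sup>+x. ennreal (v x) \<partial>?R) < \<infinity>"
    using nn_integral_eq_integral[OF _ AE] by simp
  moreover have "emeasure ?P (space ?R) = (\<integral>\<^sup>+x. ennreal (v x) \<partial>?R)"
    using vR by (subst emeasure_density[OF _ sets.top]) (auto intro!: nn_integral_cong)
  ultimately have "finite_measure ?P"
    by (intro finite_measureI) simp
  moreover have "sets ?R = sets (restrict_space borel ?U)"
    by (rule sets_restrict_space_cong) simp
  ultimately have P: "finite_borel_on ?U ?P"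
    by (simp add: finite_borel_on_def)
  have int_P: "(LINT x|?P. f x) = (LINT x:?U|lebesgue. f x * v x)" if f: "f \<in> borel_measurable borel" for f
  proof -
    have "f \<in> borel_measurable ?R"
      using f by (auto intro: measurable_restrict_space1)
    then have "(LINT x|?P. f x) = (LINT x|?R. v x * f x)"
      using vR AE by (subst integral_density) auto
    also have "\<dots> = (LINT x:?U|lborel. v x * f x)"
      by (subst integral_restrict_space) (auto simp: set_lebesgue_integral_def)
    also have "\<dots> = (LINT x:?U|lebesgue. v x * f x)"
      using f v by (intro set_integrable_lebesgue_iff(2)[symmetric]) auto
    finally show ?thesis by (simp add: mult.commute)
  qed
  have "distr_deriv_measure ?U u j ?P ?N"
    unfolding distr_deriv_measure_def
    using P finite_borel_on_null_measure[OF open_square_borel] w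
    by (auto simp: weak_partial_deriv_def int_P[OF test_functions_measurable])
  moreover have "ac_part_density ?U ?P ?N v"
    unfolding ac_part_density_def
  proof (intro conjI exI[of _ ?N] ballI finite_borel_on_null_measure lebesgue_singular_null_measure open_square_borel)
    show "set_integrable lebesgue ?U v"
      using int v by (simp add: set_integrable_lebesgue_iff)
    fix E
    assume "E \<in> sets (restrict_space borel ?U)"
    then have E: "E \<in> sets borel" "E \<subseteq> ?U"
      by (auto simp: sets_restrict_space)
    have "measure ?P E = (LINT x|?P. indicator E x)"
      using E by (simp add: spaceR Int_absorb2)
    also have "\<dots> = (LINT x:?U|lebesgue. indicator E x * v x)"
      using E by (intro int_P) simp
    also have "\<dots> = (LINT x:E|lebesgue. v x)"
      unfolding set_lebesgue_integral_def using E
      by (intro Bochner_Integration.integral_cong) (auto simp: indicator_def)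
    finally show "measure ?P E - measure ?N E =
        (LINT x:E|lebesgue. v x) + (measure ?N E - measure ?N E)" by simp
  qed
  ultimately show ?thesis by blast
qed

lemma ac_part_density_unique:
  assumes w: "weak_partial_deriv j u v" and v: "set_integrable lebesgue open_square v"
    and PN: "distr_deriv_measure open_square u j P N" and a: "ac_part_density open_square P N a"
  shows "AE x in lebesgue. x \<in> open_square \<longrightarrow> a x = v x"
proof -
  let ?U = open_square
  have fin: "finite_borel_on ?U P" "finite_borel_on ?U N"
    using PN by (auto simp: distr_deriv_measure_def)
  have test: "(LINT x|P. \<phi> x) - (LINT x|N. \<phi> x) = (LINT x:?U|lebesgue. \<phi> x * v x)"
    if "\<phi> \<in> test_functions ?U" for \<phi>
  proof -
    have "(LINT x:?U|lebesgue. u x * partial_deriv j \<phi> x) = - (LINT x:?U|lebesgue. \<phi> x * v x)"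
      using w that by (simp add: weak_partial_deriv_def)
    moreover have "(LINT x:?U|lebesgue. u x * partial_deriv j \<phi> x) = - ((LINT x|P. \<phi> x) - (LINT x|N. \<phi> x))"
      using PN that by (simp add: distr_deriv_measure_def)
    ultimately show ?thesis by linarith
  qed
  have v_eq: "measure P (?U \<inter> E) - measure N (?U \<inter> E) = (LINT x:?U \<inter> E|lebesgue. v x)"
    if "E \<in> sets borel" for E
    using signed_measure_eq_density[of "vec (-1)" "vec 1" P N v E, folded open_square_def] fin v that
      test by blast
  obtain S T where ST: "finite_borel_on ?U S" "finite_borel_on ?U T"
    "lebesgue_singular S" "lebesgue_singular T" and
    a_eq: "\<And>E. E \<in> sets (restrict_space borel ?U) \<Longrightarrow> measure P E - measure N E
             = (LINT x:E|lebesgue. a x) + (measure S E - measure T E)"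
    and a_int: "set_integrable lebesgue ?U a"
    using a unfolding ac_part_density_def by blast
  obtain Z where Z: "Z \<in> null_sets lborel" "?U - Z \<in> null_sets S"
    using ST(3) finite_borel_on_space[OF ST(1)] by (auto simp: lebesgue_singular_def)
  obtain Z' where Z': "Z' \<in> null_sets lborel" "?U - Z' \<in> null_sets T"
    using ST(4) finite_borel_on_space[OF ST(2)] by (auto simp: lebesgue_singular_def)
  have "AE x in lebesgue. indicator ?U x * a x = indicator ?U x * v x"
  proof (rule density_unique_real)
    show int: "integrable lebesgue (\<lambda>x. indicator ?U x * a x)" "integrable lebesgue (\<lambda>x. indicator ?U x * v x)"
      using a_int v by (auto simp: set_integrable_def)
    fix A :: "(real^2) set"
    assume A: "A \<in> sets lebesgue"
    then obtain B M M' where B: "A = B \<union> M" "M \<subseteq> M'" "M' \<in> null_sets lborel" "B \<in> sets lborel"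
      by (rule sets_completionE)
    \<comment> \<open>Removing \<open>Z\<close> and \<open>Z'\<close> silences the singular parts,
      yet \<open>E\<close> differs from \<open>A\<close> only by a Lebesgue null set.\<close>
    define E where "E = B - (Z \<union> Z')"
    have E: "E \<in> sets borel"
      using B(4) null_setsD2[OF Z(1)] null_setsD2[OF Z'(1)] by (simp add: E_def)
    have UE: "?U \<inter> E \<in> sets (restrict_space borel ?U)"
      using E by (auto simp: sets_restrict_space)
    have "?U \<inter> E \<in> null_sets S"
      using finite_borel_on_sets[OF ST(1) open_square_borel E]
      by (rule null_sets_subset[OF Z(2)]) (auto simp: E_def)
    then have "measure S (?U \<inter> E) = 0"
      by (simp add: measure_def null_setsD1)
    moreover have "?U \<inter> E \<in> null_sets T"
      using finite_borel_on_sets[OF ST(2) open_square_borel E]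
      by (rule null_sets_subset[OF Z'(2)]) (auto simp: E_def)
    then have "measure T (?U \<inter> E) = 0"
      by (simp add: measure_def null_setsD1)
    ultimately have *: "(LINT x:?U \<inter> E|lebesgue. a x) = (LINT x:?U \<inter> E|lebesgue. v x)"
      using a_eq[OF UE] v_eq[OF E] by simp
    have sub: "(A - E) \<union> (E - A) \<subseteq> M' \<union> (Z \<union> Z')"
      using B(1,2) by (auto simp: E_def)
    have "M' \<union> (Z \<union> Z') \<in> null_sets lborel"
      using B(3) Z(1) Z'(1) by auto
    then have null: "(A - E) \<union> (E - A) \<in> null_sets lebesgue"
      using sub null_sets_completion_iff2 by blast
    have Esets: "E \<in> sets lebesgue"
      using E by (intro sets_completionI_sets) simp
    have reduce: "(LINT x:A|lebesgue. indicator ?U x * f x) = (LINT x:?U \<inter> E|lebesgue. f x)"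
      if "integrable lebesgue (\<lambda>x. indicator ?U x * f x)" for f :: "real^2 \<Rightarrow> real"
    proof -
      have "(LINT x:A|lebesgue. indicator ?U x * f x) = (LINT x:E|lebesgue. indicator ?U x * f x)"
        using that A Esets null by (rule set_integral_null_delta)
      also have "\<dots> = (LINT x:?U \<inter> E|lebesgue. f x)"
        unfolding set_lebesgue_integral_def
        by (intro Bochner_Integration.integral_cong) (auto simp: indicator_def)
      finally show ?thesis .
    qed
    show "(LINT x:A|lebesgue. indicator ?U x * a x) = (LINT x:A|lebesgue. indicator ?U x * v x)"
      using reduce[OF int(1)] reduce[OF int(2)] * by simp
  qed
  then show ?thesis
    by eventually_elim (auto simp: indicator_def)
qed

section \<open>The homeomorphism\<close>

text \<open>The values 1 and -1 of \<open>c\<close> give the homeomorphism and its inverse.\<close>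

definition stair_map :: "real \<Rightarrow> real^2 \<Rightarrow> real^2" where
  "stair_map c x = line 1 (x $ 1) (mob (c * stair (x $ 1)) (x $ 2))"

lemma stair_map_nth [simp]:
  "stair_map c x $ 1 = x $ 1" "stair_map c x $ 2 = mob (c * stair (x $ 1)) (x $ 2)"
  by (simp_all add: stair_map_def)

lemma stair_measurable [measurable]: "stair \<in> borel_measurable borel"
  using continuous_stair by (rule borel_measurable_continuous_onI)

lemma nth_measurable [measurable]: "(\<lambda>x::real^'n. x $ i) \<in> borel_measurable borel"
  by (intro borel_measurable_continuous_onI continuous_intros)

lemma mob_stair_measurable [measurable]:
  "(\<lambda>x::real^2. mob (c * stair (x $ 1)) (x $ 2)) \<in> borel_measurable borel"
  "(\<lambda>x::real^2. mob_dy (c * stair (x $ 1)) (x $ 2)) \<in> borel_measurable borel"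
  unfolding mob_def mob_dy_def by measurable

lemma abs_sign_stair: "\<bar>c\<bar> = 1 \<Longrightarrow> \<bar>c * stair x\<bar> \<le> 1 / 2"
  using stair_bounds[of x] by (simp add: abs_mult)

lemma closed_square_abs: "x \<in> closed_square \<longleftrightarrow> \<bar>x $ 1\<bar> \<le> 1 \<and> \<bar>x $ 2\<bar> \<le> 1"
  by (auto simp: closed_square_iff abs_le_iff)

lemma stair_map_in: "\<bar>c\<bar> = 1 \<Longrightarrow> x \<in> closed_square \<Longrightarrow> stair_map c x \<in> closed_square"
  using mob_bounds[OF abs_sign_stair, of c "x $ 2" "x $ 1"] by (auto simp: closed_square_abs)

lemma stair_map_inverse:
  "\<bar>c\<bar> = 1 \<Longrightarrow> x \<in> closed_square \<Longrightarrow> stair_map (- c) (stair_map c x) = x"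
  using mob_inverse[OF abs_sign_stair, of c "x $ 2" "x $ 1"]
  by (auto simp: vec_eq_iff forall_2 closed_square_abs)

lemma continuous_stair_map:
  assumes c: "\<bar>c\<bar> = 1"
  shows "continuous_on closed_square (stair_map c)"
proof -
  have st: "continuous_on closed_square (\<lambda>x::real^2. stair (x $ 1))"
    by (rule continuous_on_compose2[OF continuous_stair]) (auto intro!: continuous_intros)
  have "1 + c * stair (x $ 1) * x $ 2 \<noteq> 0" if "x \<in> closed_square" for x :: "real^2"
    using mob_denom[OF abs_sign_stair[OF c], of "x $ 2" "x $ 1"] that by (auto simp: closed_square_abs)
  then have "continuous_on closed_square (\<lambda>x::real^2. mob (c * stair (x $ 1)) (x $ 2))"
    unfolding mob_def using st by (intro continuous_intros) auto
  then show ?thesis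
    unfolding stair_map_def[abs_def] line_eq by (intro continuous_intros)
qed

lemma homeomorphism_stair_map:
  assumes c: "\<bar>c\<bar> = 1"
  shows "homeomorphism closed_square closed_square (stair_map c) (stair_map (- c))"
proof (rule homeomorphismI)
  show "continuous_on closed_square (stair_map c)" "continuous_on closed_square (stair_map (- c))"
    using c by (auto intro: continuous_stair_map)
  show "stair_map c ` closed_square \<subseteq> closed_square" "stair_map (- c) ` closed_square \<subseteq> closed_square"
    using c stair_map_in[of c] stair_map_in[of "- c"] by auto
  show "stair_map (- c) (stair_map c x) = x" if "x \<in> closed_square" for x
    using c that by (rule stair_map_inverse)
  show "stair_map c (stair_map (- c) y) = y" if "y \<in> closed_square" for y
    using stair_map_inverse[of "- c" y] c that by simp
qed

lemma stair_map_measurable [measurable]: "stair_map c \<in> borel_measurable borel"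
proof -
  have "(\<lambda>x::real^2. (x $ 1) *\<^sub>R (axis 1 1 :: real^2) + mob (c * stair (x $ 1)) (x $ 2) *\<^sub>R (1 - axis 1 1)) \<in> borel_measurable borel"
    by measurable
  then show ?thesis by (simp add: stair_map_def[abs_def] line_eq)
qed

lemma luzin_N_stair_map:
  assumes c: "\<bar>c\<bar> = 1"
  shows "luzin_N closed_square (stair_map c)"
  unfolding luzin_N_def
proof (intro allI impI)
  fix E :: "(real^2) set"
  assume E: "E \<subseteq> closed_square" "negligible E"
  then obtain N where N: "N \<in> null_sets lborel" "E \<subseteq> N"
    by (auto simp: negligible_iff_null_sets null_sets_completion_iff2)
  \<comment> \<open>A preimage under the inverse map: it is Borel, so Fubini applies to it, and it
    contains the image of \<open>E\<close>.\<close>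
  define W where "W = stair_map (- c) -` N \<inter> closed_square"
  have Nb: "N \<in> sets borel" using N(1) by auto
  then have W: "W \<in> sets borel"
    using measurable_sets[OF stair_map_measurable[of "- c"] Nb] by (auto simp: W_def closed_square_def)
  have "AE a in lborel. {b. line 1 a b \<in> N} \<in> null_sets lborel"
    using N(1) null_sets_line[OF Nb] by blast
  then have "AE a in lborel. {b. line 1 a b \<in> W} \<in> null_sets lborel"
  proof eventually_elim
    case (elim a)
    let ?s = "c * stair a" and ?N = "{b. line 1 a b \<in> N} \<inter> {-1..1}"
    have "{b. line 1 a b \<in> N} \<in> null_sets lebesgue"
      using elim by (auto intro: null_sets_completionI)
    then have "negligible ?N"
      by (meson negligible_iff_null_sets negligible_Int)
    moreover have "mob ?s differentiable (at b within ?N)" if "b \<in> ?N" for b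
    proof -
      have "(mob ?s has_real_derivative mob_dy ?s b) (at b)"
        using that by (intro mob_has_derivative_y abs_sign_stair c) auto
      then show ?thesis
        using differentiable_at_withinI real_differentiable_def by blast
    qed
    then have "mob ?s differentiable_on ?N"
      by (simp add: differentiable_on_def)
    ultimately have "negligible (mob ?s ` ?N)"
      by (intro negligible_differentiable_image_negligible) auto
    \<comment> \<open>A vertical section of \<open>W\<close> lies in the image of the section of
      \<open>N\<close> over the same point, under a differentiable map of the line, which preserves
      null sets.\<close>
    moreover have "{b. line 1 a b \<in> W} \<subseteq> mob ?s ` ?N"
    proof
      fix b
      assume "b \<in> {b. line 1 a b \<in> W}"
      then have b: "b \<in> {-1..1}" "line 1 a (mob (- c * stair a) b) \<in> N"
        by (auto simp: W_def stair_map_def)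
      have s: "\<bar>- c * stair a\<bar> \<le> 1 / 2" using abs_sign_stair[OF c, of a] by simp
      have "\<bar>b\<bar> \<le> 1" using b(1) by auto
      then have "\<bar>mob (- c * stair a) b\<bar> \<le> 1"
        using s by (intro mob_bounds)
      then have "mob (- c * stair a) b \<in> ?N"
        using b(2) by (auto simp: abs_le_iff)
      moreover have "mob ?s (mob (- c * stair a) b) = b"
        using mob_inverse[OF s, of b] b by auto
      ultimately show "b \<in> mob ?s ` ?N" by (metis imageI)
    qed
    ultimately have "negligible {b. line 1 a b \<in> W}"
      by (rule negligible_subset)
    moreover have "{b. line 1 a b \<in> W} \<in> sets lborel"
      using measurable_sets[OF line_measurable2 W, of 1 a] by (simp add: vimage_def)
    ultimately show ?case
      by (simp add: negligible_iff_null_sets null_sets_completion_iff)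
  qed
  then have "W \<in> null_sets lborel"
    using null_sets_line[OF W] by blast
  then have "negligible W"
    by (auto simp: negligible_iff_null_sets intro: null_sets_completionI)
  moreover have "stair_map c x \<in> W" if "x \<in> E" for x
  proof -
    have "x \<in> closed_square" "x \<in> N" using that E(1) N(2) by auto
    then show ?thesis
      using stair_map_in[OF c] stair_map_inverse[OF c, of x] by (simp add: W_def)
  qed
  then have "stair_map c ` E \<subseteq> W" by blast
  ultimately show "negligible (stair_map c ` E)"
    by (rule negligible_subset)
qed

section \<open>Gradient and Jacobian of \<open>stair_map\<close>\<close>

lemma weak_deriv_fst:
  "weak_partial_deriv 1 (\<lambda>x. x $ 1) (\<lambda>_. 1)" "weak_partial_deriv 2 (\<lambda>x. x $ 1) (\<lambda>_. 0)"
  by (rule weak_partial_derivI[where C = 1]; auto simp: open_square_iff)+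

lemma mob_dy_stair_bounds:
  assumes c: "\<bar>c\<bar> = 1" and x: "x \<in> open_square"
  shows "0 < mob_dy (c * stair (x $ 1)) (x $ 2)" "mob_dy (c * stair (x $ 1)) (x $ 2) \<le> 4"
  using x by (auto simp: open_square_iff intro!: mob_dy_pos mob_dy_le abs_sign_stair[OF c])

lemma abs_mob_stair_le:
  assumes c: "\<bar>c\<bar> = 1" and x: "x \<in> open_square"
  shows "\<bar>mob (c * stair (x $ 1)) (x $ 2)\<bar> \<le> 1"
  using x by (intro mob_bounds abs_sign_stair[OF c]) (auto simp: open_square_iff)

lemma weak_deriv_snd_snd:
  assumes c: "\<bar>c\<bar> = 1"
  shows "weak_partial_deriv 2 (\<lambda>x. mob (c * stair (x $ 1)) (x $ 2))
    (\<lambda>x. mob_dy (c * stair (x $ 1)) (x $ 2))"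
proof (rule weak_partial_derivI[where C = 4])
  show "\<bar>mob (c * stair (x $ 1)) (x $ 2)\<bar> \<le> 4" if "x \<in> open_square" for x :: "real^2"
    using abs_mob_stair_le[OF c that] by simp
  show "\<bar>mob_dy (c * stair (x $ 1)) (x $ 2)\<bar> \<le> 4" if "x \<in> open_square" for x :: "real^2"
    using mob_dy_stair_bounds[OF c that] by simp
  show "((\<lambda>a. mob (c * stair (line 2 a b $ 1)) (line 2 a b $ 2)) has_real_derivative
      mob_dy (c * stair (line 2 a b $ 1)) (line 2 a b $ 2)) (at a within {-1..1})"
    if "a \<in> {-1..1}" for a b
    using mob_has_derivative_y[OF abs_sign_stair[OF c], of a b] that
    by (auto intro: has_field_derivative_at_within)
  show "continuous_on {-1..1} (\<lambda>a. mob_dy (c * stair (line 2 a b $ 1)) (line 2 a b $ 2))" for b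
  proof -
    have "(1 + c * stair b * a)\<^sup>2 \<noteq> 0" if "a \<in> {-1..1}" for a
    proof -
      have "\<bar>a\<bar> \<le> 1" using that by auto
      then show ?thesis using mob_denom[OF abs_sign_stair[OF c], of a b] by auto
    qed
    then show ?thesis
      unfolding mob_dy_def by (auto intro!: continuous_intros)
  qed
qed measurable

text \<open>On the horizontal line at height \<open>b\<close>, \<open>stair_by_parts\<close> applies
  to \<open>G s = mob (c * s) b\<close>; integrating over \<open>b\<close> assembles the result into
  \<open>stair_measure c\<close>.\<close>

lemma stair_map_test_derivative:
  assumes c: "\<bar>c\<bar> = 1" and \<phi>: "\<phi> \<in> test_functions open_square"
  shows "(LINT x:open_square|lebesgue. mob (c * stair (x $ 1)) (x $ 2) * partial_deriv 1 \<phi> x)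
    = - (c * (LINT x|stair_measure c. \<phi> x))"
proof -
  note props = test_function_props[OF \<phi>]
  obtain B where B: "B \<ge> 0" "\<And>x. x \<in> closed_square \<Longrightarrow> \<bar>\<phi> x\<bar> \<le> B"
    using continuous_bounded_on_open_square[OF props(1)] by blast
  obtain B' where B': "B' \<ge> 0" "\<And>x. x \<in> closed_square \<Longrightarrow> \<bar>partial_deriv 1 \<phi> x\<bar> \<le> B'"
    using continuous_bounded_on_open_square[OF props(2)] by blast
  have m: "\<phi> \<in> borel_measurable borel" "partial_deriv 1 \<phi> \<in> borel_measurable borel"
    using props by (auto intro: borel_measurable_continuous_onI)
  have B_all: "\<bar>\<phi> x\<bar> \<le> B" for x
    using B props(4)[of x] open_subset_closed_square by (cases "x \<in> open_square") auto
  have bd: "\<bar>mob (c * stair (x $ 1)) (x $ 2) * partial_deriv 1 \<phi> x\<bar> \<le> 1 * B'"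
    if "x \<in> open_square" for x
    using abs_mob_stair_le[OF c that] B'(2)[of x] that open_subset_closed_square
    unfolding abs_mult by (intro mult_mono) auto
  have inner: "(LINT a:{-1<..<1}|lborel. mob (c * stair a) b * partial_deriv 1 \<phi> (line 1 a b))
      = - (c * (LINT s:{-1/2..1/2}|lborel. mob_ds (c * s) b * \<phi> (line 1 (jump s) b)))"
    if b: "b \<in> {-1<..<1}" for b
  proof -
    have cs: "\<bar>c * s\<bar> \<le> 1 / 2" if "s \<in> {-1/2..1/2}" for s
      using c that by (auto simp: abs_mult)
    have b': "\<bar>b\<bar> \<le> 1" using b by auto
    have "(LINT a:{-1<..<1}|lborel. mob (c * stair a) b * partial_deriv 1 \<phi> (line 1 a b))
      = - (LINT s:{-1/2..1/2}|lborel. (c * mob_ds (c * s) b) * \<phi> (line 1 (jump s) b))"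
    proof (rule stair_by_parts[of "\<lambda>s. mob (c * s) b"])
      show "((\<lambda>s. mob (c * s) b) has_real_derivative c * mob_ds (c * s) b) (at s within {-1/2..1/2})"
        if "s \<in> {-1/2..1/2}" for s
      proof -
        have "((*) c has_real_derivative c) (at s within {-1/2..1/2})"
          by (auto intro!: derivative_eq_intros)
        from DERIV_chain2[OF mob_has_derivative_s[OF cs[OF that] b'] this]
        show ?thesis by (simp add: mult.commute)
      qed
      show "((\<lambda>a. \<phi> (line 1 a b)) has_real_derivative partial_deriv 1 \<phi> (line 1 a b)) (at a within {-1..1})" for a
        using props(3) by (rule has_field_derivative_at_within)
      have "(1 + c * s * b)\<^sup>2 \<noteq> 0" if "s \<in> {-1/2..1/2}" for s
        using mob_denom[OF cs[OF that] b'] by auto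
      then show "continuous_on {-1/2..1/2} (\<lambda>s. c * mob_ds (c * s) b)"
        unfolding mob_ds_def by (auto intro!: continuous_intros)
      show "continuous_on {-1..1} (\<lambda>a. partial_deriv 1 \<phi> (line 1 a b))"
        using continuous_on_compose2[OF props(2) continuous_on_line(1)] by auto
      show "\<phi> (line 1 (-1) b) = 0" "\<phi> (line 1 1 b) = 0"
        by (auto intro!: props(4))
    qed
    then show ?thesis by (simp add: mult.assoc set_integral_mult_right)
  qed
  have "(LINT x:open_square|lebesgue. mob (c * stair (x $ 1)) (x $ 2) * partial_deriv 1 \<phi> x)
      = (LINT b:{-1<..<1}|lborel. LINT a:{-1<..<1}|lborel. mob (c * stair a) b * partial_deriv 1 \<phi> (line 1 a b))"
    using m by (subst set_integral_open_square[where j = 1, OF _ bd]) auto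
  also have "\<dots> = (LINT b:{-1<..<1}|lborel.
      - (c * (LINT s:{-1/2..1/2}|lborel. mob_ds (c * s) b * \<phi> (line 1 (jump s) b))))"
    using inner by (intro set_lebesgue_integral_cong) auto
  also have "\<dots> = - (c * (LINT x|stair_measure c. \<phi> x))"
    by (subst integral_stair_measure[OF c m(1) B_all])
      (simp add: set_lebesgue_integral_def mult.left_commute[of _ c])
  finally show ?thesis .
qed

lemma stair_map_distr_deriv:
  assumes c: "\<bar>c\<bar> = 1"
  shows "\<exists>P N. distr_deriv_measure open_square (\<lambda>x. mob (c * stair (x $ 1)) (x $ 2)) 1 P N \<and>
    ac_part_density open_square P N (\<lambda>_. 0)"
proof (intro exI conjI)
  let ?P = "restrict_space (stair_pos c) open_square" and ?N = "restrict_space (stair_neg c) open_square"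
  note fin = finite_borel_on_stair[OF c open_square_borel]
  have "(LINT x:open_square|lebesgue. mob (c * stair (x $ 1)) (x $ 2) * partial_deriv 1 \<phi> x)
      = - ((LINT x|?P. \<phi> x) - (LINT x|?N. \<phi> x))" if "\<phi> \<in> test_functions open_square" for \<phi>
    using stair_map_test_derivative[OF c that]
      stair_pos_neg_integral[OF c open_square_borel test_function_props(4)[OF that]] by simp
  with fin show "distr_deriv_measure open_square (\<lambda>x. mob (c * stair (x $ 1)) (x $ 2)) 1 ?P ?N"
    by (simp add: distr_deriv_measure_def)
  show "ac_part_density open_square ?P ?N (\<lambda>_. 0)"
    unfolding ac_part_density_def
    using fin lebesgue_singular_stair[OF c open_square_borel]
    by (intro conjI exI[of _ ?P] exI[of _ ?N]) (auto simp: set_integrable_def set_lebesgue_integral_def)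
qed

text \<open>Existence of a density is what gives the SOME in \<open>BV_jacobian\<close> a
  meaning.\<close>

lemma stair_map_gradient:
  assumes c: "\<bar>c\<bar> = 1"
  shows "\<exists>A. is_BV_gradient_density open_square (stair_map c) A"
proof -
  \<comment> \<open>Row 2, column 1 is 0 because that derivative is purely singular.\<close>
  define A :: "real^2 \<Rightarrow> real^2^2" where
    "A x = (\<chi> i j. if i = j then (if i = 1 then 1 else mob_dy (c * stair (x $ 1)) (x $ 2)) else 0)" for x
  have "\<exists>P N. distr_deriv_measure open_square (\<lambda>x. stair_map c x $ i) j P N \<and>
          ac_part_density open_square P N (\<lambda>x. A x $ i $ j)" for i j
  proof -
    have "\<exists>P N. distr_deriv_measure open_square (\<lambda>x. x $ 1) 1 P N \<and>
          ac_part_density open_square P N (\<lambda>_. 1)"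
      by (rule weak_deriv_imp_distr_deriv[OF weak_deriv_fst(1), of 1]) auto
    moreover have "\<exists>P N. distr_deriv_measure open_square (\<lambda>x. x $ 1) 2 P N \<and>
          ac_part_density open_square P N (\<lambda>_. 0)"
      by (rule weak_deriv_imp_distr_deriv[OF weak_deriv_fst(2), of 0]) auto
    moreover have "\<exists>P N. distr_deriv_measure open_square (\<lambda>x. mob (c * stair (x $ 1)) (x $ 2)) 2 P N \<and>
          ac_part_density open_square P N (\<lambda>x. mob_dy (c * stair (x $ 1)) (x $ 2))"
      by (rule weak_deriv_imp_distr_deriv[OF weak_deriv_snd_snd[OF c], of 4])
        (use mob_dy_stair_bounds[OF c] in \<open>auto intro: less_imp_le\<close>)
    moreover note stair_map_distr_deriv[OF c]
    moreover note exhaust_2[of i] exhaust_2[of j]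
    ultimately show ?thesis
      by (elim disjE) (simp_all add: A_def)
  qed
  then show ?thesis
    unfolding is_BV_gradient_density_def by blast
qed

lemma BV_map_stair_map:
  assumes c: "\<bar>c\<bar> = 1"
  shows "BV_map open_square (stair_map c)"
  unfolding BV_map_def BV_on_def
proof (intro allI conjI)
  fix i j :: 2
  have "set_integrable lborel open_square (\<lambda>x. stair_map c x $ i)"
  proof (rule set_integrable_bounded[where C = 1])
    have "(\<lambda>x. x $ i) \<circ> stair_map c \<in> borel_measurable borel"
      by (rule measurable_comp[OF stair_map_measurable nth_measurable])
    then show "(\<lambda>x. stair_map c x $ i) \<in> borel_measurable borel" by (simp add: comp_def)
    show "\<bar>stair_map c x $ i\<bar> \<le> 1" if "x \<in> open_square" for x
      using stair_map_in[OF c, of x] that open_subset_closed_square exhaust_2[of i]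
      by (auto simp: closed_square_abs)
  qed (auto simp: bounded_open_square)
  moreover have "(\<lambda>x. stair_map c x $ i) \<in> borel_measurable borel"
    using measurable_comp[OF stair_map_measurable nth_measurable, of i c] by (simp add: comp_def)
  ultimately show "set_integrable lebesgue open_square (\<lambda>x. stair_map c x $ i)"
    by (simp add: set_integrable_lebesgue_iff)
  show "\<exists>P N. distr_deriv_measure open_square (\<lambda>x. stair_map c x $ i) j P N"
    using stair_map_gradient[OF c] unfolding is_BV_gradient_density_def by blast
qed

lemma BV_jacobian_stair_map_pos:
  assumes c: "\<bar>c\<bar> = 1"
  shows "AE x in lebesgue_on open_square. BV_jacobian open_square (stair_map c) x > 0"
proof -
  define A where "A = (SOME A. is_BV_gradient_density open_square (stair_map c) A)"
  have A: "is_BV_gradient_density open_square (stair_map c) A"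
    unfolding A_def using stair_map_gradient[OF c] by (rule someI_ex)
  have unique: "AE x in lebesgue. x \<in> open_square \<longrightarrow> A x $ i $ j = v x"
    if w: "weak_partial_deriv j (\<lambda>x. stair_map c x $ i) v" and v: "v \<in> borel_measurable borel"
      and bd: "\<And>x. x \<in> open_square \<Longrightarrow> \<bar>v x\<bar> \<le> 4" for i j v
  proof -
    have "set_integrable lborel open_square v"
      using v bd open_square_borel bounded_open_square by (rule set_integrable_bounded)
    then have "set_integrable lebesgue open_square v"
      using v by (simp add: set_integrable_lebesgue_iff)
    moreover obtain P N where "distr_deriv_measure open_square (\<lambda>x. stair_map c x $ i) j P N"
      "ac_part_density open_square P N (\<lambda>x. A x $ i $ j)"
      using A unfolding is_BV_gradient_density_def by blast
    ultimately show ?thesis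
      using w by (intro ac_part_density_unique)
  qed
  have "AE x in lebesgue. x \<in> open_square \<longrightarrow> A x $ 1 $ 1 = 1"
    by (rule unique) (use weak_deriv_fst in auto)
  moreover have "AE x in lebesgue. x \<in> open_square \<longrightarrow> A x $ 1 $ 2 = 0"
    by (rule unique) (use weak_deriv_fst in auto)
  moreover have "AE x in lebesgue. x \<in> open_square \<longrightarrow> A x $ 2 $ 2 = mob_dy (c * stair (x $ 1)) (x $ 2)"
    by (rule unique) (use weak_deriv_snd_snd[OF c] mob_dy_stair_bounds[OF c] in \<open>auto simp: less_imp_le\<close>)
  \<comment> \<open>As row 1, column 2 vanishes, the determinant is the product of the diagonal
    entries, \<open>mob_dy\<close>.\<close>
  ultimately have "AE x in lebesgue. x \<in> open_square \<longrightarrow> 0 < BV_jacobian open_square (stair_map c) x"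
  proof eventually_elim
    case (elim x)
    then show ?case
      using mob_dy_stair_bounds(1)[OF c] by (simp add: BV_jacobian_def A_def[symmetric] det_2)
  qed
  moreover have "open_square \<in> sets lebesgue"
    by (intro sets_completionI_sets) simp
  ultimately show ?thesis
    by (subst AE_restrict_space_iff) auto
qed

section \<open>Failure of the Sobolev property\<close>

lemma test_functions_mono: "U \<subseteq> V \<Longrightarrow> test_functions U \<subseteq> test_functions V"
  by (force simp: test_functions_def)

text \<open>A weak derivative \<open>v\<close> would make \<open>stair_measure c\<close> absolutely
  continuous on a box; being carried by a null set, it would vanish there, against
  \<open>stair_measure_box_pos\<close>.\<close>

lemma not_sobolev_stair_map:
  assumes c: "\<bar>c\<bar> = 1"
  shows "\<not> sobolev_map open_square (stair_map c)"
proof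
  let ?U = "open_square"
  \<comment> \<open>\<open>v\<close> is only locally integrable, so the comparison of measures takes
    place on a box whose closure is a compact subset of the open square.\<close>
  let ?B = "box (vec (-3/4)) (vec (3/4)) :: (real^2) set"
  let ?P = "restrict_space (stair_pos c) ?B" and ?N = "restrict_space (stair_neg c) ?B"
  assume sobolev: "sobolev_map ?U (stair_map c)"
  obtain v where v: "locally_integrable_on ?U v"
    "\<And>\<phi>. \<phi> \<in> test_functions ?U \<Longrightarrow> (LINT x:?U|lebesgue. stair_map c x $ 2 * partial_deriv 1 \<phi> x)
                = - (LINT x:?U|lebesgue. \<phi> x * v x)"
    using sobolev[unfolded sobolev_map_def, THEN spec[of _ 2], THEN conjunct2, THEN spec[of _ 1]]
    by blast
  have BU: "?B \<subseteq> ?U"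
    by (auto simp: mem_box_cart open_square_iff forall_2)
  have "cbox (vec (-3/4)) (vec (3/4)) \<subseteq> ?U"
    by (auto simp: mem_box_cart open_square_iff forall_2)
  then have "set_integrable lebesgue (cbox (vec (-3/4)) (vec (3/4))) v"
    using v(1) by (simp add: locally_integrable_on_def)
  then have vB: "set_integrable lebesgue ?B v"
    by (rule set_integrable_subset) (auto simp: box_subset_cbox)
  have test: "(LINT x|?P. \<phi> x) - (LINT x|?N. \<phi> x) = (LINT x:?B|lebesgue. \<phi> x * v x)"
    if \<phi>: "\<phi> \<in> test_functions ?B" for \<phi>
  proof -
    have \<phi>U: "\<phi> \<in> test_functions ?U" using \<phi> test_functions_mono[OF BU] by blast
    have zero: "\<phi> x = 0" if "x \<notin> ?B" for x
      using \<phi> that by (auto simp: test_functions_def)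
    have "(LINT x|?P. \<phi> x) - (LINT x|?N. \<phi> x) = c * (LINT x|stair_measure c. \<phi> x)"
      by (rule stair_pos_neg_integral[OF c _ zero]) auto
    also have "\<dots> = (LINT x:?U|lebesgue. \<phi> x * v x)"
      using v(2)[OF \<phi>U] stair_map_test_derivative[OF c \<phi>U] by simp
    also have "\<dots> = (LINT x:?B|lebesgue. \<phi> x * v x)"
      unfolding set_lebesgue_integral_def using zero BU
      by (intro Bochner_Integration.integral_cong) (auto simp: indicator_def)
    finally show ?thesis .
  qed
  have B: "?B \<in> sets borel" by simp
  have eq: "c * measure (stair_measure c) (?B \<inter> E) = (LINT x:?B \<inter> E|lebesgue. v x)" if "E \<in> sets borel" for E
    using signed_measure_eq_density[OF finite_borel_on_stair[OF c B] vB test that]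
      stair_pos_neg_measure[OF c B that] by simp
  obtain Z where Z: "Z \<in> null_sets lborel"
    and Z0: "\<forall>c. \<forall>E\<in>sets borel. E \<inter> Z = {} \<longrightarrow> emeasure (stair_measure c) E = 0"
    using stair_measure_singular by blast
  have Zb: "Z \<in> sets borel" using Z by auto
  interpret finite_measure "stair_measure c"
    by (rule finite_measure_stair_measure[OF c])
  have "?B \<inter> Z \<in> null_sets lborel"
    using Z by (rule null_set_Int1) simp
  then have "?B \<inter> Z \<in> null_sets lebesgue"
    by (rule null_sets_completionI)
  then have "(LINT x:?B \<inter> Z|lebesgue. v x) = 0"
    unfolding set_lebesgue_integral_def
    by (intro integral_eq_zero_AE) (auto dest!: AE_not_in simp: indicator_def elim: eventually_mono)
  then have "measure (stair_measure c) (?B \<inter> Z) = 0"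
    using eq[OF Zb] c by auto
  moreover have "emeasure (stair_measure c) (?B - Z) = 0"
    by (intro Z0[rule_format]) (use Zb in auto)
  then have "measure (stair_measure c) (?B - Z) = 0"
    by (simp add: measure_def)
  moreover have "measure (stair_measure c) ?B = measure (stair_measure c) (?B \<inter> Z) + measure (stair_measure c) (?B - Z)"
    using Zb by (subst finite_measure_Union[symmetric]) (auto simp: Int_Diff_Un)
  ultimately have "emeasure (stair_measure c) ?B = 0"
    by (simp add: emeasure_eq_measure)
  then show False
    using stair_measure_box_pos[OF c] by simp
qed

theorem theorem3:
  "\<exists>f g :: real^2 \<Rightarrow> real^2.
     homeomorphism closed_square closed_square f g \<and>
     BV_map open_square f \<and>
     BV_map open_square g \<and>
     luzin_N closed_square f \<and>
     luzin_N closed_square g \<and>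
     (AE x in lebesgue_on open_square. BV_jacobian open_square f x > 0) \<and>
     (AE x in lebesgue_on open_square. BV_jacobian open_square g x > 0) \<and>
     \<not> sobolev_map open_square f \<and>
     \<not> sobolev_map open_square g"
  by (intro exI[of _ "stair_map 1"] exI[of _ "stair_map (- 1)"] conjI homeomorphism_stair_map
      BV_map_stair_map luzin_N_stair_map BV_jacobian_stair_map_pos not_sobolev_stair_map) simp_all

end
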